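(* Let $\xi$ be an extremal real number and let $\gamma=(1+\sqrt5)/2$. There exists a constant $c>0$ such that, for any algebraic integer $\alpha\in\mathbb{C}$ of degree $\le 3$ over $\mathbb{Q}$, we have $$|\xi-\alpha|\ge c\,H(\alpha)^{-\gamma^2-1}.$$
   Context: A real number $\xi$ is called extremal if it is neither rational nor quadratic irrational (i.e. not algebraic over $\mathbb{Q}$ of degree at most $2$) and there exists a constant $c'>0$ such that, for every real number $X\ge 1$, the inequalities $|x_0|\le X$, $|x_0\xi-x_1|\le c'X^{-1/\gamma}$, $|x_0\xi^2-x_2|\le c'X^{-1/\gamma}$ have a non-zero solution $(x_0,x_1,x_2)\in\mathbb{Z}^3$, where $\gamma=(1+\sqrt5)/2$. The height $H(P)$ of a polynomial $P\in\mathbb{R}[T]$ is the maximum of the absolute values of its coefficients, and the height $H(\alpha)$ of an algebraic number $\alpha$ is the height of its irreducible polynomial over $\mathbb{Z}$ (primitive integer polynomial, irreducible over $\mathbb Q$, having $\alpha$ as a root). *)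

theory Defs
  imports Complex_Main "HOL-Computational_Algebra.Computational_Algebra"
begin

definition golden :: real
  where "golden = (1 + sqrt 5) / 2"

text \<open>The zero polynomial has height \<open>0\<close>.\<close>
definition poly_height :: "real poly \<Rightarrow> real"
  where "poly_height p = Max ((\<lambda>i. \<bar>coeff p i\<bar>) ` {..degree p})"

text \<open>
  The irreducible polynomial over \<open>\<int>\<close> of an algebraic number is determined up to sign; we choose
  the sign that makes the leading coefficient positive. The value is meaningful only for algebraic
  numbers, see \<open>ex1_int_min_poly\<close> below.
\<close>
definition is_int_min_poly :: "'a :: field_char_0 \<Rightarrow> int poly \<Rightarrow> bool"
  where "is_int_min_poly x p \<longleftrightarrow>
           content p = 1 \<and> irreducible (map_poly of_int p :: rat poly) \<and>
           poly (map_poly of_int p) x = 0 \<and> lead_coeff p > 0"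

definition int_min_poly :: "'a :: field_char_0 \<Rightarrow> int poly"
  where "int_min_poly x = (THE p. is_int_min_poly x p)"

definition alg_degree :: "'a :: field_char_0 \<Rightarrow> nat"
  where "alg_degree x = degree (int_min_poly x)"

definition alg_height :: "'a :: field_char_0 \<Rightarrow> real"
  where "alg_height x = poly_height (map_poly of_int (int_min_poly x))"

definition extremal :: "real \<Rightarrow> bool"
  where "extremal \<xi> \<longleftrightarrow>
           \<not> (algebraic \<xi> \<and> alg_degree \<xi> \<le> 2) \<and>
           (\<exists>c'>0. \<forall>X\<ge>1. \<exists>x0 x1 x2 :: int. (x0, x1, x2) \<noteq> (0, 0, 0) \<and>
              \<bar>real_of_int x0\<bar> \<le> X \<and>
              \<bar>real_of_int x0 * \<xi> - real_of_int x1\<bar> \<le> c' * X powr (- 1 / golden) \<and>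
              \<bar>real_of_int x0 * \<xi>\<^sup>2 - real_of_int x2\<bar> \<le> c' * X powr (- 1 / golden))"

lemma of_rat_poly_of_int:
  "map_poly of_rat (map_poly of_int p :: rat poly) = (map_poly of_int p :: 'a :: field_char_0 poly)"
  by (rule poly_eqI) (simp add: coeff_map_poly)

lemma map_poly_of_rat_mult:
  "map_poly of_rat (p * q) = map_poly of_rat p * (map_poly of_rat q :: 'a :: field_char_0 poly)"
  by (rule poly_eqI) (simp add: coeff_map_poly coeff_mult of_rat_sum of_rat_mult)

lemma rat_poly_clear_denoms:
  fixes p :: "rat poly"
  obtains d :: int and q :: "int poly"
  where "d > 0" "smult (of_int d) p = map_poly of_int q"
proof -
  have "\<exists>d q. (d::int) > 0 \<and> smult (of_int d) p = map_poly of_int q"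
  proof (induction p)
    case 0
    show ?case by (intro exI[of _ 1] exI[of _ 0]) auto
  next
    case (pCons a p)
    then obtain d q where dq: "(d::int) > 0" "smult (of_int d) p = map_poly of_int q"
      by blast
    obtain m n where a: "a = of_int m / of_int n" "n > 0"
      by (metis Rat_cases Fract_of_int_quotient)
    have "smult (of_int (n * d)) (pCons a p) = map_poly of_int (pCons (d * m) (smult n q))"
    proof -
      have "smult (of_int (n * d)) p = map_poly of_int (smult n q)"
        using dq(2) by (metis map_poly_smult of_int_0 of_int_mult smult_smult)
      then show ?thesis
        using a by (simp add: map_poly_pCons)
    qed
    then show ?case
      using a dq by (intro exI[of _ "n * d"] exI) auto
  qed
  then show ?thesis using that by blast
qed

lemma is_int_min_poly_exists:
  fixes x :: "'a :: field_char_0"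
  assumes "algebraic x"
  shows "\<exists>p. is_int_min_poly x p"
proof -
  define R where "R p \<longleftrightarrow> p \<noteq> 0 \<and> poly (map_poly of_int p) x = 0" for p :: "int poly"
  obtain p0 where "R p0"
    using assms unfolding R_def by (metis algebraicE')
  then obtain p where p: "R p" and min: "\<And>q. R q \<Longrightarrow> degree p \<le> degree q"
    using exists_least_lemma[of "\<lambda>n. \<exists>p. R p \<and> degree p = n"]
    by (metis ex_has_least_nat)
  define s where "s = sgn (lead_coeff p)"
  define q where "q = smult s (primitive_part p)"
  have p0: "p \<noteq> 0" using p by (simp add: R_def)
  have s: "s \<in> {1, -1}" using p0 by (auto simp: s_def sgn_if)
  have cp: "content p > 0"
    using p0 by (metis content_eq_zero_iff normalize_content normalize_int_def zero_less_abs_iff)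
  have p_eq: "p = smult (s * content p) q"
    using s content_times_primitive_part[of p] by (auto simp: q_def)
  have content: "content q = 1"
    using s p0 by (auto simp: q_def)
  have deg: "degree q = degree p"
    using s by (auto simp: q_def)
  have lead: "lead_coeff q > 0"
  proof -
    have "lead_coeff p = s * content p * lead_coeff q"
      using arg_cong[OF p_eq, of "\<lambda>f. coeff f (degree p)"] by (simp add: deg)
    then have "content p * lead_coeff q = s * lead_coeff p"
      using s by auto
    also have "\<dots> = \<bar>lead_coeff p\<bar>"
      by (simp add: s_def abs_sgn mult.commute)
    also have "\<dots> > 0" using p0 by simp
    finally show ?thesis
      using cp by (simp add: zero_less_mult_iff)
  qed
  have root: "poly (map_poly of_int q) x = 0"
  proof -
    have "map_poly of_int p = smult (of_int (s * content p)) (map_poly of_int q :: 'a poly)"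
      by (subst p_eq) (rule poly_eqI, simp add: coeff_map_poly)
    then have "of_int (s * content p) * poly (map_poly of_int q) x = 0"
      using p unfolding R_def by (metis poly_smult)
    moreover have "s * content p \<noteq> 0" using s cp by auto
    ultimately show ?thesis by (metis mult_eq_0_iff of_int_eq_0_iff)
  qed
  have min': "degree p \<le> degree r"
    if r: "r \<noteq> 0" "poly (map_poly of_rat r) x = 0" for r :: "rat poly"
  proof -
    obtain d r' where dr: "d > 0" "smult (of_int d) r = map_poly of_int r'"
      by (rule rat_poly_clear_denoms)
    have "map_poly of_int r' = (map_poly of_rat (smult (of_int d) r) :: 'a poly)"
      by (simp add: dr(2) of_rat_poly_of_int)
    also have "\<dots> = smult (of_int d) (map_poly of_rat r)"
      by (rule poly_eqI) (simp add: coeff_map_poly of_rat_mult)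
    finally have "poly (map_poly of_int r') x = 0"
      using r by simp
    moreover have "r' \<noteq> 0" using dr r by auto
    ultimately have "degree p \<le> degree r'" by (intro min) (simp add: R_def)
    also have "degree r' = degree (map_poly of_int r' :: rat poly)"
      by (rule degree_map_poly[symmetric]) auto
    also have "\<dots> = degree r"
      using dr by (metis degree_smult_eq less_irrefl of_int_eq_0_iff)
    finally show ?thesis .
  qed
  have degq: "degree (map_poly of_int q :: rat poly) = degree p"
    using deg by (simp add: degree_map_poly)
  have q0: "(map_poly of_int q :: rat poly) \<noteq> 0"
    using content by (auto simp: map_poly_eq_0_iff)
  have "irreducible (map_poly of_int q :: rat poly)"
  proof (rule irreducibleI)
    show "(map_poly of_int q :: rat poly) \<noteq> 0" by (fact q0)
  next
    show "\<not> is_unit (map_poly of_int q :: rat poly)"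
    proof
      assume "is_unit (map_poly of_int q :: rat poly)"
      then have "degree q = 0"
        using degq deg q0 by (simp add: is_unit_iff_degree)
      then obtain c where "q = [:c:]" by (auto elim: degree_eq_zeroE)
      then show False using root lead by (auto simp: map_poly_pCons)
    qed
  next
    fix a b :: "rat poly"
    assume ab: "map_poly of_int q = a * b"
    have ab0: "a \<noteq> 0" "b \<noteq> 0" using ab q0 by auto
    have sum: "degree a + degree b = degree p"
      using ab0 degq ab by (simp add: degree_mult_eq)
    have "map_poly of_rat a * map_poly of_rat b = (map_poly of_int q :: 'a poly)"
      by (metis ab map_poly_of_rat_mult of_rat_poly_of_int)
    then have "poly (map_poly of_rat a) x * poly (map_poly of_rat b) x = 0"
      using root by (metis poly_mult)
    then have "degree p \<le> degree a \<or> degree p \<le> degree b"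
      using min' ab0 by (metis mult_eq_0_iff)
    then show "is_unit a \<or> is_unit b"
      using sum ab0 by (auto simp: is_unit_iff_degree)
  qed
  then have "is_int_min_poly x q"
    using content lead root by (simp add: is_int_min_poly_def)
  then show ?thesis ..
qed

lemma is_int_min_poly_unique:
  fixes x :: "'a :: field_char_0"
  assumes p: "is_int_min_poly x p" and q: "is_int_min_poly x q"
  shows "p = q"
proof -
  let ?P = "map_poly of_int p :: rat poly" and ?Q = "map_poly of_int q :: rat poly"
  have irr: "irreducible ?P" "irreducible ?Q"
    using p q by (auto simp: is_int_min_poly_def)
  have root: "poly (map_poly of_rat ?P) x = 0" "poly (map_poly of_rat ?Q) x = 0"
    using p q by (auto simp: is_int_min_poly_def of_rat_poly_of_int)
  define R where "R f \<longleftrightarrow> f \<noteq> 0 \<and> poly (map_poly of_rat f) x = 0" for f :: "rat poly"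
  have "R ?P" using irr root by (auto simp: R_def)
  then obtain f where f: "R f" and min: "\<And>g. R g \<Longrightarrow> degree f \<le> degree g"
    by (metis ex_has_least_nat)
  have f0: "f \<noteq> 0" using f by (simp add: R_def)
  have nonunit: "\<not> is_unit f"
  proof
    assume "is_unit f"
    then obtain c where "f = [:c:]" "c \<noteq> 0"
      using f0 by (auto simp: is_unit_iff_degree elim: degree_eq_zeroE)
    then show False using f by (simp add: R_def map_poly_pCons)
  qed
  have dvd: "f dvd g" if "poly (map_poly of_rat g) x = 0" for g
  proof (rule ccontr)
    assume "\<not> f dvd g"
    then have nz: "g mod f \<noteq> 0" by (simp add: mod_eq_0_iff_dvd)
    have "map_poly of_rat g = (map_poly of_rat (g div f * f + g mod f) :: 'a poly)"
      by simp
    also have "\<dots> = map_poly of_rat (g div f * f) + map_poly of_rat (g mod f)"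
      by (rule poly_eqI) (simp only: coeff_map_poly of_rat_add coeff_add of_rat_0)
    finally have "poly (map_poly of_rat (g mod f)) x = 0"
      using that f by (simp add: map_poly_of_rat_mult R_def)
    then have "degree f \<le> degree (g mod f)" using nz by (intro min) (simp add: R_def)
    then show False using degree_mod_less'[OF f0 nz] by simp
  qed
  have assoc: "\<exists>c. c \<noteq> 0 \<and> g = smult c f"
    if g: "irreducible g" "poly (map_poly of_rat g) x = 0" for g
  proof -
    obtain u where u: "g = f * u" using dvd[OF g(2)] by (elim dvdE)
    have "is_unit u" using irreducibleD[OF g(1) u] nonunit by blast
    then obtain c where "u = [:c:]" "c \<noteq> 0"
      by (metis degree_eq_zeroE is_unit_iff_degree not_is_unit_0 pCons_0_0)
    then show ?thesis using u by auto
  qed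
  obtain a b where ab: "a \<noteq> 0" "?P = smult a f" "?Q = smult b f"
    using assoc[OF irr(1) root(1)] assoc[OF irr(2) root(2)] by blast
  define c where "c = b / a"
  have QP: "?Q = smult c ?P" using ab by (simp add: c_def)
  obtain m n where c: "c = of_int m / of_int n" "n > 0"
    by (metis Rat_cases Fract_of_int_quotient)
  have eq: "smult n q = smult m p"
  proof (rule poly_eqI)
    fix i
    have "of_int (coeff q i) = c * of_int (coeff p i)"
      using arg_cong[OF QP, of "\<lambda>f. coeff f i"] by (simp add: coeff_map_poly)
    then have "of_int (n * coeff q i) = (of_int (m * coeff p i) :: rat)"
      using c by (simp add: field_simps)
    then show "coeff (smult n q) i = coeff (smult m p) i"
      by (simp only: of_int_eq_iff coeff_smult)
  qed
  have "content (smult n q) = content (smult m p)" using eq by simp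
  then have abs: "\<bar>n\<bar> = \<bar>m\<bar>"
    using p q by (simp add: is_int_min_poly_def)
  then have "n * lead_coeff q = m * lead_coeff p"
    using arg_cong[OF eq, of lead_coeff] c(2) by (auto split: if_splits)
  then have "m > 0"
    using c(2) p q unfolding is_int_min_poly_def by (metis zero_less_mult_pos2 mult_pos_pos)
  with abs c(2) have "m = n" by simp
  with eq c(2) show ?thesis by (metis less_irrefl smult_cancel)
qed

lemma ex1_int_min_poly:
  fixes x :: "'a :: field_char_0"
  assumes "algebraic x"
  shows "\<exists>!p. is_int_min_poly x p"
  using is_int_min_poly_exists[OF assms] is_int_min_poly_unique by blast

lemma is_int_min_poly_int_min_poly:
  fixes x :: "'a :: field_char_0"
  assumes "algebraic x"
  shows "is_int_min_poly x (int_min_poly x)"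
  unfolding int_min_poly_def using ex1_int_min_poly[OF assms] by (rule theI')

end

theory Submission
  imports Defs
begin

text \<open>
  The idea is that a good approximation \<open>\<alpha>\<close> yields a small value \<open>P(\<xi>)\<close> of a monic cubic
  integer polynomial, and that such a value is incompatible with the rigid structure of the
  integer points that make \<open>\<xi>\<close> extremal. Write \<open>\<gamma>\<close> for the golden ratio.

  Multiplying the minimal polynomial of \<open>\<alpha>\<close> by a power of \<open>T\<close> gives a monic cubic integer
  polynomial \<open>P = T\<^sup>3 + p T\<^sup>2 + q T + r\<close> of height \<open>H = H(\<alpha>)\<close> with root \<open>\<alpha>\<close>, and
  \<open>\<bar>P(\<xi>)\<bar>\<close> is at most a constant times \<open>H \<bar>\<xi> - \<alpha>\<bar>\<close> when \<open>\<bar>\<xi> - \<alpha>\<bar> \<le> 1\<close>. So it suffices to bound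
  \<open>\<bar>P(\<xi>)\<bar>\<close> below by a constant times \<open>H\<close> to the power \<open>- \<gamma>\<^sup>2\<close>
  (lemma \<open>cubic_value_lower_bound\<close>).

  Suppose that \<open>z = (z0, z1, z2)\<close> is an integer point of size \<open>X = \<bar>z0\<bar>\<close> whose distance from
  \<open>z0 (1, \<xi>, \<xi>\<^sup>2)\<close> is \<open>O(1/X)\<close>, and that \<open>f\<close> is an integer linear form with coefficients
  \<open>O(X powr (2\<gamma> - 3))\<close> whose value \<open>f(z)\<close> is nonzero and bounded. The integer
  \<open>y = - (p z2 + q z1 + r z0)\<close> differs from \<open>z0 \<xi>\<^sup>3\<close> by at most \<open>X \<bar>P(\<xi>)\<bar> + O(H/X)\<close>, so
  \<open>(z1, z2, y)\<close> is close to \<open>\<xi> z\<close>. Hence \<open>f(z1, z2, y) - \<xi> f(z)\<close> is small if \<open>\<bar>P(\<xi>)\<bar>\<close> is small.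
  But it is the difference of an integer and a bounded nonzero multiple of an irrational number,
  hence bounded away from \<open>0\<close>. If \<open>X\<close> is at least a large multiple of \<open>H powr (\<gamma>\<^sup>2 / 2)\<close>, the term
  \<open>H/X\<close> is harmless and \<open>\<bar>P(\<xi>)\<bar>\<close> is at least a constant times \<open>X powr (2 - 2\<gamma>)\<close>. The points
  come in a sequence in which each size is at most a constant times the \<open>\<gamma>\<close>-th power of the
  preceding one, so \<open>X\<close> can be chosen of order at most \<open>H powr (\<gamma>\<^sup>3 / 2)\<close>, and then
  \<open>X powr (2 - 2\<gamma>)\<close> is of the required order.

  Such points and forms are found (lemma \<open>points_and_forms\<close>) among the minimal points \<open>x\<^sub>m\<close> of
  \<open>\<xi>\<close>, in the sense of Davenport and Schmidt. Let \<open>X\<^sub>m\<close> be the size of \<open>x\<^sub>m\<close>, and call \<open>i\<close> a turn if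
  three consecutive minimal points around \<open>x\<^sub>i\<close> are linearly independent. At a turn,
  nonvanishing of two integer determinants forces \<open>X\<^bsub>i+1\<^esub>\<close> to be of order \<open>X\<^sub>i powr \<gamma>\<close> and the error of
  \<open>x\<^sub>i\<close> to be \<open>O(1/X\<^sub>i)\<close>. Between two consecutive turns \<open>i < j\<close> the points stay in one plane,
  and the key estimate \<open>X_consecutive_le\<close> shows that this does not last long: \<open>X\<^sub>j\<close> is still
  \<open>O(X\<^sub>i powr \<gamma>)\<close>. It rests on reading a point as a symmetric matrix; the product of matrices
  \<open>x\<^sub>j adj(x\<^bsub>j+1\<^esub>) x\<^sub>j\<close> is again an integer point close to the line, surprisingly small, and it lies
  outside the plane. For three consecutive turns \<open>g < h < i\<close> the plane spanned at \<open>g\<close> and the point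
  \<open>x\<^sub>i\<close> are the required pair.
\<close>

section \<open>Algebraic numbers and their integer minimal polynomials\<close>

lemma is_int_min_poly_dvd:
  fixes x :: "'a :: field_char_0"
  assumes p: "is_int_min_poly x p" and q: "poly (map_poly of_int q) x = 0"
  shows "(map_poly of_int p :: rat poly) dvd map_poly of_int q"
proof -
  define root where "root f \<longleftrightarrow> poly (map_poly of_rat f) x = 0" for f :: "rat poly"
  let ?P = "map_poly of_int p :: rat poly"
  have irr: "irreducible ?P" and "root ?P"
    using p by (auto simp: is_int_min_poly_def root_def of_rat_poly_of_int)
  then have "?P \<noteq> 0 \<and> root ?P" by auto
  then obtain f where f: "f \<noteq> 0" "root f"
    and min: "\<And>g. g \<noteq> 0 \<Longrightarrow> root g \<Longrightarrow> degree f \<le> degree g"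
    using ex_has_least_nat[of "\<lambda>f. f \<noteq> 0 \<and> root f" ?P degree] by auto
  have f_dvd: "f dvd g" if "root g" for g
  proof (rule ccontr)
    assume "\<not> f dvd g"
    then have nz: "g mod f \<noteq> 0" by (simp add: mod_eq_0_iff_dvd)
    have "map_poly of_rat g = (map_poly of_rat (g div f * f + g mod f) :: 'a poly)"
      by simp
    also have "\<dots> = map_poly of_rat (g div f * f) + map_poly of_rat (g mod f)"
      by (rule poly_eqI) (simp only: coeff_map_poly of_rat_add coeff_add of_rat_0)
    finally have "root (g mod f)"
      using that f by (simp add: map_poly_of_rat_mult root_def)
    then show False using min[OF nz] degree_mod_less'[OF f(1) nz] by simp
  qed
  have "\<not> is_unit f"
  proof
    assume "is_unit f"
    then obtain c where "f = [:c:]" "c \<noteq> 0"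
      using f by (auto simp: is_unit_iff_degree elim: degree_eq_zeroE)
    then show False using f by (simp add: root_def map_poly_pCons)
  qed
  then have "?P dvd f"
    using f_dvd[OF \<open>root ?P\<close>] irr by (meson irreducible_altdef)
  also have "f dvd map_poly of_int q"
    using q by (intro f_dvd) (simp add: root_def of_rat_poly_of_int)
  finally show ?thesis .
qed

text \<open>
  This is Gauss's lemma: a primitive polynomial dividing a monic integer polynomial over \<open>\<rat>\<close>
  divides it over \<open>\<int>\<close>, so its leading coefficient is a unit.
\<close>

lemma is_int_min_poly_algebraic_int:
  fixes x :: "'a :: field_char_0"
  assumes p: "is_int_min_poly x p" and x: "algebraic_int x"
  shows "lead_coeff p = 1"
proof -
  obtain q :: "int poly" where q: "lead_coeff q = 1" "poly (map_poly of_int q) x = 0"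
    using x by (auto simp: algebraic_int_altdef_ipoly)
  obtain u where u: "map_poly of_int q = map_poly of_int p * (u :: rat poly)"
    using is_int_min_poly_dvd[OF p q(2)] by (elim dvdE)
  obtain d v where dv: "d > 0" "smult (of_int d) u = map_poly of_int v"
    by (rule rat_poly_clear_denoms)
  have of_int_poly_mult: "map_poly of_int (a * b) = (map_poly of_int a * map_poly of_int b :: rat poly)"
    for a b :: "int poly"
    by (rule poly_eqI) (simp add: coeff_map_poly coeff_mult)
  have "map_poly of_int (smult d q) = smult (of_int d) (map_poly of_int q :: rat poly)"
    by (rule poly_eqI) (simp add: coeff_map_poly)
  also have "\<dots> = map_poly of_int p * map_poly of_int v"
    by (simp add: u flip: dv(2))
  also have "\<dots> = map_poly of_int (p * v)"
    by (simp add: of_int_poly_mult)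
  finally have eq: "smult d q = p * v"
    by (metis (mono_tags, lifting) coeff_map_poly of_int_0 of_int_eq_iff poly_eqI)
  have "content q dvd 1"
    using q(1) by (metis content_dvd_coeff)
  then have "content q = 1"
    by (metis content_eq_zero_iff is_unit_content_iff)
  then have "d = content v"
    using arg_cong[OF eq, of content] dv(1) p by (simp add: content_mult is_int_min_poly_def)
  then obtain w where "v = smult d w"
    by (metis content_times_primitive_part)
  then have "smult d q = smult d (p * w)"
    using eq by simp
  then have "q = p * w"
    using dv(1) by (metis less_irrefl smult_cancel)
  then have "lead_coeff p dvd 1"
    using q(1) by (metis dvd_triv_left lead_coeff_mult)
  then show ?thesis
    using p by (auto simp: is_int_min_poly_def)
qed

text \<open>
  The only way in which the proof uses that \<open>\<xi>\<close> is neither rational nor quadratic.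
\<close>

lemma not_quadratic_imp_independent_powers:
  fixes \<xi> :: real
  assumes "\<not> (algebraic \<xi> \<and> alg_degree \<xi> \<le> 2)"
    and "real_of_int a + of_int b * \<xi> + of_int c * \<xi>\<^sup>2 = 0"
  shows "a = 0 \<and> b = 0 \<and> c = 0"
proof (rule ccontr)
  assume nz: "\<not> (a = 0 \<and> b = 0 \<and> c = 0)"
  define q where "q = [:a, b, c:]"
  have q: "q \<noteq> 0" "poly (map_poly of_int q) \<xi> = 0"
    using nz assms(2) by (auto simp: q_def map_poly_pCons algebra_simps power2_eq_square)
  then have alg: "algebraic \<xi>"
    by (intro algebraicI'[of "map_poly of_int q"]) (auto simp: coeff_map_poly map_poly_eq_0_iff)
  have "(map_poly of_int (int_min_poly \<xi>) :: rat poly) dvd map_poly of_int q"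
    by (rule is_int_min_poly_dvd[OF is_int_min_poly_int_min_poly[OF alg] q(2)])
  then have "degree (map_poly of_int (int_min_poly \<xi>) :: rat poly) \<le> degree (map_poly of_int q :: rat poly)"
    using q(1) by (intro dvd_imp_degree_le) (auto simp: map_poly_eq_0_iff)
  then have "alg_degree \<xi> \<le> degree q"
    by (simp add: degree_map_poly alg_degree_def)
  also have "degree q \<le> 2"
    by (simp add: q_def)
  finally show False using alg assms(1) by blast
qed

text \<open>
  Lower degrees are absorbed by multiplying the minimal polynomial by a power of \<open>T\<close>, which changes
  neither the height nor the leading coefficient.
\<close>

lemma alg_int_monic_cubic:
  fixes \<alpha> :: complex
  assumes "algebraic_int \<alpha>" "alg_degree \<alpha> \<le> 3"
  obtains p q r :: int
  where "\<alpha> ^ 3 + of_int p * \<alpha>\<^sup>2 + of_int q * \<alpha> + of_int r = 0"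
    "\<bar>of_int p\<bar> \<le> alg_height \<alpha>" "\<bar>of_int q\<bar> \<le> alg_height \<alpha>" "1 \<le> alg_height \<alpha>"
proof -
  define f where "f = int_min_poly \<alpha>"
  define F where "F = monom 1 (3 - degree f) * f"
  have f: "is_int_min_poly \<alpha> f"
    using assms(1) unfolding f_def
    by (intro is_int_min_poly_int_min_poly algebraic_int_imp_algebraic)
  have monic: "lead_coeff f = 1"
    by (rule is_int_min_poly_algebraic_int[OF f assms(1)])
  have deg: "degree f \<le> 3"
    using assms(2) by (simp add: alg_degree_def f_def)
  have height: "\<bar>of_int (coeff f i)\<bar> \<le> alg_height \<alpha>" for i
  proof -
    let ?f = "map_poly real_of_int f"
    have "\<bar>coeff ?f i\<bar> \<le> Max ((\<lambda>i. \<bar>coeff ?f i\<bar>) ` {..degree ?f})"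
    proof (cases "i \<le> degree ?f")
      case True
      then show ?thesis by (intro Max_ge) auto
    next
      case False
      then have "\<bar>coeff ?f i\<bar> \<le> \<bar>coeff ?f 0\<bar>"
        by (simp add: coeff_eq_0)
      also have "\<dots> \<le> Max ((\<lambda>i. \<bar>coeff ?f i\<bar>) ` {..degree ?f})"
        by (intro Max_ge) auto
      finally show ?thesis .
    qed
    then show ?thesis
      by (simp add: alg_height_def poly_height_def f_def coeff_map_poly)
  qed
  have H1: "1 \<le> alg_height \<alpha>"
    using height[of "degree f"] monic by simp
  have Fheight: "\<bar>of_int (coeff F i)\<bar> \<le> alg_height \<alpha>" for i
    using height H1 by (auto simp: F_def coeff_monom_mult)
  have "f \<noteq> 0"
    using monic by auto
  then have F3: "degree F = 3" "coeff F 3 = 1"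
    using deg monic
    by (auto simp: F_def degree_mult_eq degree_monom_eq coeff_monom_mult monom_eq_0_iff)
  have "map_poly of_int F = (monom 1 (3 - degree f) * map_poly of_int f :: complex poly)"
    by (rule poly_eqI) (simp add: F_def coeff_map_poly coeff_monom_mult)
  then have "poly (map_poly of_int F) \<alpha> = 0"
    using f by (simp add: is_int_min_poly_def)
  then have "\<alpha> ^ 3 + of_int (coeff F 2) * \<alpha>\<^sup>2 + of_int (coeff F 1) * \<alpha> + of_int (coeff F 0) = 0"
    using F3 by (simp add: poly_altdef degree_map_poly coeff_map_poly numeral_3_eq_3 numeral_2_eq_2
        algebra_simps)
  then show ?thesis
    using Fheight H1 that by blast
qed

section \<open>The golden ratio and real powers\<close>

lemma golden_sq: "golden * golden = golden + 1"
  by (simp add: golden_def field_simps)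

lemma golden_bounds: "3 / 2 < golden" "golden < 2"
proof -
  have "2 < sqrt 5" by (rule real_less_rsqrt) simp
  moreover have "sqrt 5 < 3" by (rule real_less_lsqrt) simp_all
  ultimately show "3 / 2 < golden" "golden < 2" by (simp_all add: golden_def)
qed

lemma inverse_golden: "1 / golden = golden - 1"
proof -
  have "1 = (golden - 1) * golden" using golden_sq by algebra
  then show ?thesis using golden_bounds by (subst eq_commute, intro nonzero_eq_divide_eq[THEN iffD2]) auto
qed

text \<open>
  All estimates relate powers of two sizes. This rule passes from one exponent to another; the
  exponents that arise are then simplified with \<open>\<gamma>\<^sup>2 = \<gamma> + 1\<close>.
\<close>

lemma powr_raise:
  fixes x y K :: real
  assumes "x powr a \<le> K * y powr b" "0 \<le> K" "0 \<le> p"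
  shows "x powr (a * p) \<le> K powr p * y powr (b * p)"
proof -
  have "(x powr a) powr p \<le> (K * y powr b) powr p"
    using assms by (intro powr_mono2) auto
  also have "\<dots> = K powr p * (y powr b) powr p"
    using assms by (simp add: powr_mult)
  finally show ?thesis by (simp add: powr_powr)
qed

section \<open>Integer points near the line through \<open>(1, \<xi>, \<xi>\<^sup>2)\<close>\<close>

datatype triple = Triple (c0: int) (c1: int) (c2: int)

text \<open>
  The cross product. For independent \<open>x\<close>, \<open>y\<close> it is an integer linear form whose kernel is the
  plane spanned by \<open>x\<close> and \<open>y\<close>, and its pairing with \<open>z\<close> is the determinant of \<open>x\<close>, \<open>y\<close>, \<open>z\<close>.
\<close>

definition wedge :: "triple \<Rightarrow> triple \<Rightarrow> triple"
  where "wedge x y = Triple (c1 x * c2 y - c2 x * c1 y) (c2 x * c0 y - c0 x * c2 y)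
                            (c0 x * c1 y - c1 x * c0 y)"

definition pairing :: "triple \<Rightarrow> triple \<Rightarrow> int"
  where "pairing q x = c0 q * c0 x + c1 q * c1 x + c2 q * c2 x"

definition comb :: "int \<Rightarrow> triple \<Rightarrow> int \<Rightarrow> triple \<Rightarrow> triple"
  where "comb a x b y = Triple (a * c0 x + b * c0 y) (a * c1 x + b * c1 y) (a * c2 x + b * c2 y)"

text \<open>
  The determinant of the symmetric matrix with rows \<open>(c0 x, c1 x)\<close> and \<open>(c1 x, c2 x)\<close>. It vanishes on
  \<open>(1, \<xi>, \<xi>\<^sup>2)\<close>, hence is small on points near that line.
\<close>

definition disc :: "triple \<Rightarrow> int"
  where "disc x = c0 x * c2 x - (c1 x)\<^sup>2"

text \<open>
  The polar form of \<^const>\<open>disc\<close>: \<open>polar x x = 2 * disc x\<close>. It is also the trace of \<open>x adj(y)\<close> when points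
  are read as symmetric matrices.
\<close>

definition polar :: "triple \<Rightarrow> triple \<Rightarrow> int"
  where "polar x y = c0 x * c2 y - 2 * c1 x * c1 y + c2 x * c0 y"

text \<open>
  Up to sign, the image of \<open>y\<close> under the reflection in \<open>x\<close> for the quadratic form \<^const>\<open>disc\<close>, multiplied
  by \<open>disc x\<close>. By the Cayley-Hamilton theorem it is the matrix product \<open>x adj(y) x\<close>. The form given
  here exhibits it as a combination of \<open>x\<close> and \<open>y\<close>, while the product form explains why it is small:
  the rank-one main terms of the three factors annihilate each other.
\<close>

definition reflect :: "triple \<Rightarrow> triple \<Rightarrow> triple"
  where "reflect x y = comb (polar x y) x (- disc x) y"

definition size1 :: "triple \<Rightarrow> real"
  where "size1 q = \<bar>of_int (c0 q)\<bar> + \<bar>of_int (c1 q)\<bar> + \<bar>of_int (c2 q)\<bar>"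

definition quad :: "real \<Rightarrow> triple \<Rightarrow> real"
  where "quad \<xi> q = of_int (c0 q) + of_int (c1 q) * \<xi> + of_int (c2 q) * \<xi>\<^sup>2"

definition err :: "real \<Rightarrow> triple \<Rightarrow> real"
  where "err \<xi> x = max \<bar>of_int (c0 x) * \<xi> - of_int (c1 x)\<bar> \<bar>of_int (c0 x) * \<xi>\<^sup>2 - of_int (c2 x)\<bar>"

abbreviation "zero3 \<equiv> Triple 0 0 0"

lemmas triple_defs = wedge_def pairing_def comb_def disc_def polar_def reflect_def

lemma pairing_wedge_self [simp]: "pairing (wedge x y) x = 0" "pairing (wedge x y) y = 0"
  by (simp_all add: triple_defs algebra_simps)

lemma pairing_comb: "pairing q (comb a x b y) = a * pairing q x + b * pairing q y"
  by (simp add: triple_defs algebra_simps)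

lemma err_nonneg: "0 \<le> err \<xi> x"
  by (simp add: err_def)

text \<open>
  Every estimate of this section is obtained by substituting these expressions for the second and
  third coordinates; the terms without an error factor then cancel.
\<close>

lemma errE:
  obtains e1 e2 where "of_int (c1 x) = of_int (c0 x) * \<xi> - e1"
    "of_int (c2 x) = of_int (c0 x) * \<xi>\<^sup>2 - e2" "\<bar>e1\<bar> \<le> err \<xi> x" "\<bar>e2\<bar> \<le> err \<xi> x"
  by (rule that[of "of_int (c0 x) * \<xi> - of_int (c1 x)" "of_int (c0 x) * \<xi>\<^sup>2 - of_int (c2 x)"])
    (auto simp: err_def)

lemma abs_mult_mono: "\<bar>a\<bar> \<le> A \<Longrightarrow> \<bar>b\<bar> \<le> B \<Longrightarrow> \<bar>a * b\<bar> \<le> A * (B :: real)"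
  by (simp add: abs_mult mult_mono')

lemma err_comb:
  "err \<xi> (comb a x b y) \<le> \<bar>of_int a\<bar> * err \<xi> x + \<bar>of_int b\<bar> * err \<xi> y"
proof -
  obtain e1 e2 where e: "of_int (c1 x) = of_int (c0 x) * \<xi> - e1"
    "of_int (c2 x) = of_int (c0 x) * \<xi>\<^sup>2 - e2" "\<bar>e1\<bar> \<le> err \<xi> x" "\<bar>e2\<bar> \<le> err \<xi> x"
    by (rule errE)
  obtain f1 f2 where f: "of_int (c1 y) = of_int (c0 y) * \<xi> - f1"
    "of_int (c2 y) = of_int (c0 y) * \<xi>\<^sup>2 - f2" "\<bar>f1\<bar> \<le> err \<xi> y" "\<bar>f2\<bar> \<le> err \<xi> y"
    by (rule errE)
  let ?w = "comb a x b y"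
  have 1: "of_int (c0 ?w) * \<xi> - of_int (c1 ?w) = of_int a * e1 + of_int b * f1"
    and 2: "of_int (c0 ?w) * \<xi>\<^sup>2 - of_int (c2 ?w) = of_int a * e2 + of_int b * f2"
    by (simp_all add: comb_def e f algebra_simps)
  have "\<bar>of_int a * e1 + of_int b * f1\<bar> \<le> \<bar>of_int a\<bar> * err \<xi> x + \<bar>of_int b\<bar> * err \<xi> y"
    "\<bar>of_int a * e2 + of_int b * f2\<bar> \<le> \<bar>of_int a\<bar> * err \<xi> x + \<bar>of_int b\<bar> * err \<xi> y"
    using e f by (intro order.trans[OF abs_triangle_ineq] add_mono abs_mult_mono order_refl; simp)+
  then show ?thesis
    unfolding err_def[of \<xi> ?w] 1 2 by simp
qed

lemma pairing_approx:
  "\<bar>of_int (pairing q x) - of_int (c0 x) * quad \<xi> q\<bar> \<le> size1 q * err \<xi> x"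
proof -
  obtain e1 e2 where e: "of_int (c1 x) = of_int (c0 x) * \<xi> - e1"
    "of_int (c2 x) = of_int (c0 x) * \<xi>\<^sup>2 - e2" "\<bar>e1\<bar> \<le> err \<xi> x" "\<bar>e2\<bar> \<le> err \<xi> x"
    by (rule errE)
  have "of_int (pairing q x) - of_int (c0 x) * quad \<xi> q = - (of_int (c1 q) * e1 + of_int (c2 q) * e2)"
    by (simp add: pairing_def quad_def e algebra_simps)
  also have "\<bar>\<dots>\<bar> \<le> \<bar>of_int (c1 q)\<bar> * err \<xi> x + \<bar>of_int (c2 q)\<bar> * err \<xi> x"
    unfolding abs_minus_cancel
    by (intro order.trans[OF abs_triangle_ineq] add_mono abs_mult_mono order_refl e)
  also have "\<dots> \<le> size1 q * err \<xi> x"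
    by (simp add: size1_def distrib_right err_nonneg)
  finally show ?thesis .
qed

text \<open>
  The determinant of \<open>(1, \<xi>, \<xi>\<^sup>2)\<close>, \<open>x\<close>, \<open>y\<close>: subtracting multiples of the first row leaves only the
  errors of \<open>x\<close> and \<open>y\<close>.
\<close>

lemma quad_wedge: "\<bar>quad \<xi> (wedge x y)\<bar> \<le> 2 * err \<xi> x * err \<xi> y"
proof -
  obtain e1 e2 where e: "of_int (c1 x) = of_int (c0 x) * \<xi> - e1"
    "of_int (c2 x) = of_int (c0 x) * \<xi>\<^sup>2 - e2" "\<bar>e1\<bar> \<le> err \<xi> x" "\<bar>e2\<bar> \<le> err \<xi> x"
    by (rule errE)
  obtain f1 f2 where f: "of_int (c1 y) = of_int (c0 y) * \<xi> - f1"
    "of_int (c2 y) = of_int (c0 y) * \<xi>\<^sup>2 - f2" "\<bar>f1\<bar> \<le> err \<xi> y" "\<bar>f2\<bar> \<le> err \<xi> y"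
    by (rule errE)
  have "quad \<xi> (wedge x y) = e1 * f2 - e2 * f1"
    by (simp add: quad_def wedge_def e f algebra_simps power2_eq_square)
  also have "\<bar>\<dots>\<bar> \<le> err \<xi> x * err \<xi> y + err \<xi> x * err \<xi> y"
    by (intro order.trans[OF abs_triangle_ineq4] add_mono abs_mult_mono e f)
  finally show ?thesis by simp
qed

lemma size1_wedge:
  assumes "err \<xi> x \<le> 1" "1 \<le> \<bar>c0 y\<bar>" "\<bar>c0 x\<bar> \<le> \<bar>c0 y\<bar>" "err \<xi> y \<le> err \<xi> x"
  shows "size1 (wedge x y) \<le> (6 + 2 * \<bar>\<xi>\<bar> + 2 * \<xi>\<^sup>2) * (\<bar>of_int (c0 y)\<bar> * err \<xi> x)"
proof -
  let ?X = "real_of_int (c0 x)" and ?Y = "real_of_int (c0 y)"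
  let ?M = "\<bar>?Y\<bar> * err \<xi> x"
  obtain e1 e2 where e: "of_int (c1 x) = of_int (c0 x) * \<xi> - e1"
    "of_int (c2 x) = of_int (c0 x) * \<xi>\<^sup>2 - e2" "\<bar>e1\<bar> \<le> err \<xi> x" "\<bar>e2\<bar> \<le> err \<xi> x"
    by (rule errE)
  obtain f1 f2 where f: "of_int (c1 y) = of_int (c0 y) * \<xi> - f1"
    "of_int (c2 y) = of_int (c0 y) * \<xi>\<^sup>2 - f2" "\<bar>f1\<bar> \<le> err \<xi> y" "\<bar>f2\<bar> \<le> err \<xi> y"
    by (rule errE)
  have f': "\<bar>f1\<bar> \<le> err \<xi> x" "\<bar>f2\<bar> \<le> err \<xi> x"
    using f assms(4) by linarith+
  have XY: "\<bar>?X\<bar> \<le> \<bar>?Y\<bar>" "1 \<le> \<bar>?Y\<bar>"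
    using assms(2,3) by linarith+
  have first: "\<bar>?Y * e1 - ?X * f1\<bar> \<le> 2 * ?M"
    using abs_mult_mono[OF order_refl e(3), of ?Y] abs_mult_mono[OF XY(1) f'(1)] by linarith
  have second: "\<bar>?Y * e2 - ?X * f2\<bar> \<le> 2 * ?M"
    using abs_mult_mono[OF order_refl e(4), of ?Y] abs_mult_mono[OF XY(1) f'(2)] by linarith
  have "\<bar>e1 * f2 - e2 * f1\<bar> \<le> 2 * (err \<xi> x * err \<xi> x)"
    using abs_mult_mono[OF e(3) f'(2)] abs_mult_mono[OF e(4) f'(1)] by linarith
  also have "err \<xi> x * err \<xi> x \<le> ?M"
    using XY assms(1) err_nonneg by (intro mult_right_mono) auto
  finally have third: "\<bar>e1 * f2 - e2 * f1\<bar> \<le> 2 * ?M" by simp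
  have w0: "of_int (c0 (wedge x y)) =
      \<xi> * (?Y * e2 - ?X * f2) - \<xi>\<^sup>2 * (?Y * e1 - ?X * f1) + (e1 * f2 - e2 * f1)"
    by (simp add: wedge_def e f algebra_simps power2_eq_square)
  have w1: "of_int (c1 (wedge x y)) = - (?Y * e2 - ?X * f2)"
    and w2: "of_int (c2 (wedge x y)) = ?Y * e1 - ?X * f1"
    by (simp_all add: wedge_def e f algebra_simps power2_eq_square)
  have "\<bar>of_int (c0 (wedge x y))\<bar> \<le> \<bar>\<xi>\<bar> * (2 * ?M) + \<xi>\<^sup>2 * (2 * ?M) + 2 * ?M"
    using abs_mult_mono[OF order_refl second, of \<xi>] abs_mult_mono[OF order_refl first, of "\<xi>\<^sup>2"]
      third unfolding w0 by (auto simp: abs_le_iff)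
  then show ?thesis
    using first second unfolding size1_def w1 w2 abs_minus_cancel distrib_right by linarith
qed

lemma disc_bound:
  assumes "err \<xi> x \<le> 1" "1 \<le> \<bar>c0 x\<bar>"
  shows "\<bar>of_int (disc x)\<bar> \<le> (2 + 2 * \<bar>\<xi>\<bar>) * (\<bar>of_int (c0 x)\<bar> * err \<xi> x)"
proof -
  let ?X = "real_of_int (c0 x)"
  obtain e1 e2 where e: "of_int (c1 x) = of_int (c0 x) * \<xi> - e1"
    "of_int (c2 x) = of_int (c0 x) * \<xi>\<^sup>2 - e2" "\<bar>e1\<bar> \<le> err \<xi> x" "\<bar>e2\<bar> \<le> err \<xi> x"
    by (rule errE)
  have X: "1 \<le> \<bar>?X\<bar>" using assms(2) by linarith
  have "of_int (disc x) = 2 * \<xi> * (?X * e1) - ?X * e2 - e1 * e1"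
    by (simp add: disc_def e algebra_simps power2_eq_square)
  also have "\<bar>\<dots>\<bar> \<le> \<bar>2 * \<xi>\<bar> * (\<bar>?X\<bar> * err \<xi> x) + \<bar>?X\<bar> * err \<xi> x + 1 * err \<xi> x"
    using assms(1) e
    by (intro order.trans[OF abs_triangle_ineq4] add_mono abs_mult_mono order_refl) auto
  also have "1 * err \<xi> x \<le> \<bar>?X\<bar> * err \<xi> x"
    using X err_nonneg by (intro mult_right_mono)
  finally show ?thesis by (simp add: algebra_simps abs_mult)
qed

text \<open>
  A product of three factors \<open>x\<close>, \<open>y\<close>, \<open>x\<close> would have size \<open>X\<^sup>2 Y\<close>. Since the main terms cancel, every
  surviving term of the first coordinate carries an error of \<open>y\<close> or two errors of \<open>x\<close>; in the error
  of the result, one of the factors \<open>X\<close> accompanying an error of \<open>y\<close> becomes an error of \<open>x\<close>.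
\<close>

lemma reflect_bounds:
  fixes \<xi> :: real and x y :: triple
  assumes "err \<xi> x \<le> 1" "1 \<le> \<bar>c0 x\<bar>"
  defines "X \<equiv> \<bar>real_of_int (c0 x)\<bar>" and "Y \<equiv> \<bar>real_of_int (c0 y)\<bar>"
  shows "\<bar>of_int (c0 (reflect x y))\<bar> \<le>
      (5 + 4 * \<bar>\<xi>\<bar>) * (X\<^sup>2 * err \<xi> y + Y * (err \<xi> x)\<^sup>2)"
    and "err \<xi> (reflect x y) \<le>
      (5 + 4 * \<bar>\<xi>\<bar>) * (X * err \<xi> x * err \<xi> y + Y * (err \<xi> x)\<^sup>2)"
proof -
  let ?x = "real_of_int (c0 x)" and ?y = "real_of_int (c0 y)"
  obtain e1 e2 where e: "of_int (c1 x) = of_int (c0 x) * \<xi> - e1"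
    "of_int (c2 x) = of_int (c0 x) * \<xi>\<^sup>2 - e2" "\<bar>e1\<bar> \<le> err \<xi> x" "\<bar>e2\<bar> \<le> err \<xi> x"
    by (rule errE)
  obtain f1 f2 where f: "of_int (c1 y) = of_int (c0 y) * \<xi> - f1"
    "of_int (c2 y) = of_int (c0 y) * \<xi>\<^sup>2 - f2" "\<bar>f1\<bar> \<le> err \<xi> y" "\<bar>f2\<bar> \<le> err \<xi> y"
    by (rule errE)
  have X: "1 \<le> X" using assms(2) unfolding X_def by linarith
  have Y: "0 \<le> Y" by (simp add: Y_def)
  have xX: "\<bar>?x\<bar> \<le> X" "\<bar>?y\<bar> \<le> Y" by (simp_all add: X_def Y_def)
  have e1X: "\<bar>e1\<bar> \<le> X" using e(3) X assms(1) by linarith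
  note nonneg = err_nonneg[of \<xi> x] err_nonneg[of \<xi> y]
  define S where "S = X\<^sup>2 * err \<xi> y"
  define T where "T = Y * (err \<xi> x)\<^sup>2"
  have ST: "0 \<le> S" "0 \<le> T" using X Y nonneg by (simp_all add: S_def T_def)
  have "of_int (c0 (reflect x y)) =
      2 * \<xi> * (?x * ?x * f1) - ?x * ?x * f2 - 2 * (?x * e1 * f1) + ?y * (e1 * e1)"
    by (simp add: triple_defs e f algebra_simps power2_eq_square)
  also have "\<bar>\<dots>\<bar> \<le> \<bar>2 * \<xi>\<bar> * (X * X * err \<xi> y) + X * X * err \<xi> y
      + 2 * (X * X * err \<xi> y) + Y * (err \<xi> x * err \<xi> x)"
    by (intro order.trans[OF abs_triangle_ineq4] order.trans[OF abs_triangle_ineq] add_mono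
        abs_mult_mono order_refl e f xX e1X) simp_all
  also have "\<dots> = (2 * \<bar>\<xi>\<bar> + 3) * S + 1 * T"
    by (simp add: S_def T_def algebra_simps power2_eq_square abs_mult)
  also have "\<dots> \<le> (5 + 4 * \<bar>\<xi>\<bar>) * S + (5 + 4 * \<bar>\<xi>\<bar>) * T"
    by (rule add_mono[OF mult_right_mono mult_right_mono]) (use ST in auto)
  finally show "\<bar>of_int (c0 (reflect x y))\<bar> \<le>
      (5 + 4 * \<bar>\<xi>\<bar>) * (X\<^sup>2 * err \<xi> y + Y * (err \<xi> x)\<^sup>2)"
    by (simp add: S_def T_def distrib_left)
  have "of_int (polar x y) =
      2 * \<xi> * (?x * f1) - ?x * f2 + 2 * \<xi> * (?y * e1) - ?y * e2 - 2 * (e1 * f1)"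
    by (simp add: polar_def e f algebra_simps power2_eq_square)
  also have "\<bar>\<dots>\<bar> \<le> \<bar>2 * \<xi>\<bar> * (X * err \<xi> y) + X * err \<xi> y + \<bar>2 * \<xi>\<bar> * (Y * err \<xi> x)
      + Y * err \<xi> x + 2 * (X * err \<xi> y)"
    by (intro order.trans[OF abs_triangle_ineq4] order.trans[OF abs_triangle_ineq] add_mono
        abs_mult_mono order_refl e f xX e1X) simp_all
  finally have polar: "\<bar>of_int (polar x y)\<bar> \<le>
      (2 * \<bar>\<xi>\<bar> + 3) * (X * err \<xi> y) + (2 * \<bar>\<xi>\<bar> + 1) * (Y * err \<xi> x)"
    by (simp add: algebra_simps abs_mult)
  define S' where "S' = X * err \<xi> x * err \<xi> y"
  have S': "0 \<le> S'" using X nonneg by (simp add: S'_def)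
  have "err \<xi> (reflect x y) \<le>
      \<bar>of_int (polar x y)\<bar> * err \<xi> x + \<bar>of_int (disc x)\<bar> * err \<xi> y"
    unfolding reflect_def using err_comb[of \<xi> "polar x y" x "- disc x" y] by simp
  also have "\<dots> \<le> ((2 * \<bar>\<xi>\<bar> + 3) * (X * err \<xi> y) + (2 * \<bar>\<xi>\<bar> + 1) * (Y * err \<xi> x)) * err \<xi> x
      + ((2 + 2 * \<bar>\<xi>\<bar>) * (X * err \<xi> x)) * err \<xi> y"
    using polar disc_bound[OF assms(1,2)] nonneg unfolding X_def
    by (intro add_mono mult_right_mono)
  also have "\<dots> = (5 + 4 * \<bar>\<xi>\<bar>) * S' + (2 * \<bar>\<xi>\<bar> + 1) * T"
    by (simp add: S'_def T_def algebra_simps power2_eq_square)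
  also have "\<dots> \<le> (5 + 4 * \<bar>\<xi>\<bar>) * S' + (5 + 4 * \<bar>\<xi>\<bar>) * T"
    by (rule add_mono[OF mult_right_mono mult_right_mono]) (use ST S' in auto)
  finally show "err \<xi> (reflect x y) \<le>
      (5 + 4 * \<bar>\<xi>\<bar>) * (X * err \<xi> x * err \<xi> y + Y * (err \<xi> x)\<^sup>2)"
    by (simp add: S'_def T_def distrib_left)
qed

lemma err_scale: "err \<xi> (comb d x 0 y) = \<bar>of_int d\<bar> * err \<xi> x"
proof -
  have "of_int (c0 (comb d x 0 y)) * \<xi> - of_int (c1 (comb d x 0 y))
      = of_int d * (of_int (c0 x) * \<xi> - of_int (c1 x))"
    "of_int (c0 (comb d x 0 y)) * \<xi>\<^sup>2 - of_int (c2 (comb d x 0 y))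
      = of_int d * (of_int (c0 x) * \<xi>\<^sup>2 - of_int (c2 x))"
    by (simp_all add: comb_def algebra_simps)
  then show ?thesis
    by (simp add: err_def abs_mult max_mult_distrib_left)
qed

lemma nearest_multiple:
  fixes s d :: int
  assumes "d > 0"
  obtains a where "2 * \<bar>s - a * d\<bar> \<le> d"
proof -
  let ?a = "(2 * s + d) div (2 * d)"
  have "2 * (s - ?a * d) = (2 * s + d) mod (2 * d) - d"
    using div_mult_mod_eq[of "2 * s + d" "2 * d"] by (simp add: algebra_simps)
  moreover have "0 \<le> (2 * s + d) mod (2 * d)" "(2 * s + d) mod (2 * d) < 2 * d"
    using assms by auto
  ultimately show ?thesis by (intro that[of ?a]) linarith
qed

text \<open>
  Consecutive minimal points form a basis of the lattice of integer points in their plane: reduce \<open>z\<close>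
  modulo \<open>x\<close> and \<open>y\<close> to a combination with coefficients at most \<open>1/2\<close> in absolute value. The remainder
  is smaller than \<open>y\<close> and closer to the line than \<open>x\<close>, so it vanishes by minimality.
\<close>

lemma lattice_basis:
  assumes wedge: "wedge x y \<noteq> zero3" and plane: "pairing (wedge x y) z = 0"
    and lt: "\<bar>c0 x\<bar> < \<bar>c0 y\<bar>" "err \<xi> y < err \<xi> x"
    and min: "\<And>w. w \<noteq> zero3 \<Longrightarrow> \<bar>c0 w\<bar> < \<bar>c0 y\<bar> \<Longrightarrow> err \<xi> x \<le> err \<xi> w"
  obtains a b where "z = comb a x b y"
proof -
  define q where "q = wedge x y"
  define d where "d = pairing q q"
  define s where "s = pairing (wedge z y) q"
  define t where "t = pairing (wedge x z) q"
  have "d > 0"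
  proof -
    have "c0 q \<noteq> 0 \<or> c1 q \<noteq> 0 \<or> c2 q \<noteq> 0"
      using wedge unfolding q_def[symmetric] by (cases q) auto
    then have "0 < c0 q * c0 q \<or> 0 < c1 q * c1 q \<or> 0 < c2 q * c2 q"
      by (auto simp: zero_less_mult_iff linorder_neq_iff)
    moreover have "0 \<le> c0 q * c0 q" "0 \<le> c1 q * c1 q" "0 \<le> c2 q * c2 q"
      by simp_all
    ultimately show ?thesis unfolding d_def pairing_def by linarith
  qed
  \<comment> \<open>Cramer's rule in the plane; multiplying by \<open>d\<close> keeps all coefficients integral\<close>
  have cramer: "comb d z 0 z = comb s x t y"
  proof -
    have "d * c z = s * c x + t * c y + pairing q z * c q" if "c \<in> {c0, c1, c2}" for c
      using that unfolding d_def s_def t_def q_def pairing_def wedge_def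
      by (auto simp: algebra_simps)
    then show ?thesis
      using plane unfolding comb_def q_def by simp
  qed
  obtain a where a: "2 * \<bar>s - a * d\<bar> \<le> d" using \<open>d > 0\<close> by (rule nearest_multiple)
  obtain b where b: "2 * \<bar>t - b * d\<bar> \<le> d" using \<open>d > 0\<close> by (rule nearest_multiple)
  define w where "w = comb 1 z (-1) (comb a x b y)"
  have w: "comb d w 0 w = comb (s - a * d) x (t - b * d) y"
    using cramer by (simp add: w_def comb_def algebra_simps)
  have "2 * (d * \<bar>c0 w\<bar>) = 2 * \<bar>c0 (comb d w 0 w)\<bar>"
    using \<open>d > 0\<close> by (simp add: comb_def abs_mult)
  also have "\<dots> \<le> 2 * (\<bar>s - a * d\<bar> * \<bar>c0 x\<bar>) + 2 * (\<bar>t - b * d\<bar> * \<bar>c0 y\<bar>)"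
    using abs_triangle_ineq[of "(s - a * d) * c0 x" "(t - b * d) * c0 y"]
    unfolding w by (simp add: comb_def flip: abs_mult)
  also have "\<dots> \<le> d * \<bar>c0 x\<bar> + d * \<bar>c0 y\<bar>"
    using mult_right_mono[OF a, of "\<bar>c0 x\<bar>"] mult_right_mono[OF b, of "\<bar>c0 y\<bar>"] by simp
  also have "\<dots> < d * (2 * \<bar>c0 y\<bar>)"
    using \<open>d > 0\<close> lt(1) by (simp flip: distrib_left)
  finally have small: "\<bar>c0 w\<bar> < \<bar>c0 y\<bar>"
    using \<open>d > 0\<close> by simp
  have a': "2 * \<bar>real_of_int (s - a * d)\<bar> \<le> of_int d" and b': "2 * \<bar>real_of_int (t - b * d)\<bar> \<le> of_int d"
    using a b by linarith+
  have "2 * (of_int d * err \<xi> w) = 2 * err \<xi> (comb d w 0 w)"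
    using \<open>d > 0\<close> by (simp add: err_scale)
  also have "\<dots> \<le> 2 * \<bar>of_int (s - a * d)\<bar> * err \<xi> x + 2 * \<bar>of_int (t - b * d)\<bar> * err \<xi> y"
    unfolding w using err_comb[of \<xi> "s - a * d" x "t - b * d" y] by simp
  also have "\<dots> \<le> of_int d * err \<xi> x + of_int d * err \<xi> y"
    using a' b' by (intro add_mono mult_right_mono err_nonneg)
  also have "\<dots> < of_int d * (2 * err \<xi> x)"
    using \<open>d > 0\<close> lt(2) by (simp flip: distrib_left)
  finally have "err \<xi> w < err \<xi> x"
    using \<open>d > 0\<close> by simp
  then have "w = zero3"
    using min[OF _ small] by force
  then have "z = comb a x b y"
    by (cases z) (simp add: w_def comb_def)
  then show ?thesis by (rule that)
qed

text \<open>
  These are the points on the cone over the conic \<open>(u\<^sup>2, u v, v\<^sup>2)\<close>; the coprime pair \<open>(u, v)\<close> is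
  \<open>c1 x / c0 x\<close> in lowest terms.
\<close>

lemma disc_zero_imp_parametrised:
  assumes "disc x = 0" "c0 x \<noteq> 0"
  obtains t u v where "u \<noteq> 0" "t \<noteq> 0" "x = Triple (t * u\<^sup>2) (t * u * v) (t * v\<^sup>2)"
proof -
  define h where "h = gcd (c0 x) (c1 x)"
  obtain u v where uv: "c0 x = h * u" "c1 x = h * v" "coprime u v"
    using assms(2) unfolding h_def by (metis gcd_coprime_exists gcd_eq_0_iff mult.commute)
  have nz: "h \<noteq> 0" "u \<noteq> 0" using uv(1) assms(2) by auto
  have "h * (u * c2 x) = h * (h * v\<^sup>2)"
    using assms(1) by (simp add: disc_def uv power2_eq_square algebra_simps)
  then have eq: "u * c2 x = h * v\<^sup>2" using nz by simp
  then have "u dvd h"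
    using uv(3) by (metis coprime_dvd_mult_left_iff coprime_power_right_iff dvd_triv_left)
  then obtain t where t: "h = u * t" by (elim dvdE)
  have "c2 x = t * v\<^sup>2" using eq t nz by simp
  then have "x = Triple (t * u\<^sup>2) (t * u * v) (t * v\<^sup>2)"
    using uv t by (cases x) (simp add: power2_eq_square mult_ac)
  then show ?thesis using that nz t by auto
qed

text \<open>
  If \<open>disc x = 0\<close>, then \<open>x\<close> comes from a rational approximation \<open>v/u\<close> of \<open>\<xi>\<close> with \<open>u\<^sup>2 \<le> \<bar>c0 x\<bar>\<close>. The forms
  \<open>v y0 - u y1\<close> and \<open>v y1 - u y2\<close> cut out the line through \<open>x\<close>, so one of them is a nonzero integer at any
  independent \<open>y\<close>; both are at most a constant times \<open>\<bar>u\<bar> * err \<xi> y\<close>.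
\<close>

lemma disc_zero_bound:
  assumes "disc x = 0" "1 \<le> \<bar>c0 x\<bar>" "wedge y x \<noteq> zero3" "\<bar>c0 y\<bar> \<le> \<bar>c0 x\<bar>"
    "err \<xi> x \<le> err \<xi> y" "err \<xi> y \<le> 1"
  shows "1 \<le> (2 + 2 * \<bar>\<xi>\<bar>) * (\<bar>of_int (c0 x)\<bar> powr (1 / 2) * err \<xi> y)"
proof -
  obtain t u v where nz: "u \<noteq> 0" "t \<noteq> 0" and x: "x = Triple (t * u\<^sup>2) (t * u * v) (t * v\<^sup>2)"
    using assms(1,2) by (elim disc_zero_imp_parametrised) auto
  define \<delta> where "\<delta> = of_int u * \<xi> - of_int v"
  have v: "of_int v = of_int u * \<xi> - \<delta>" by (simp add: \<delta>_def)
  obtain f1 f2 where f: "of_int (c1 y) = of_int (c0 y) * \<xi> - f1"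
    "of_int (c2 y) = of_int (c0 y) * \<xi>\<^sup>2 - f2" "\<bar>f1\<bar> \<le> err \<xi> y" "\<bar>f2\<bar> \<le> err \<xi> y"
    by (rule errE)
  have u1: "1 \<le> \<bar>real_of_int u\<bar>" and t1: "1 \<le> \<bar>real_of_int t\<bar>"
    using nz by linarith+
  have tud: "\<bar>of_int t\<bar> * \<bar>of_int u\<bar> * \<bar>\<delta>\<bar> \<le> err \<xi> y"
  proof -
    have "\<bar>of_int t\<bar> * \<bar>of_int u\<bar> * \<bar>\<delta>\<bar> = \<bar>of_int (c0 x) * \<xi> - of_int (c1 x)\<bar>"
      unfolding \<delta>_def x by (simp add: algebra_simps power2_eq_square flip: abs_mult)
    also have "\<dots> \<le> err \<xi> x" by (simp add: err_def)
    finally show ?thesis using assms(5) by linarith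
  qed
  have \<delta>: "\<bar>\<delta>\<bar> \<le> \<bar>of_int u\<bar> * err \<xi> y"
  proof -
    have "1 * \<bar>\<delta>\<bar> \<le> \<bar>of_int t\<bar> * \<bar>of_int u\<bar> * \<bar>\<delta>\<bar>"
      using mult_mono[OF t1 u1] by (intro mult_right_mono) auto
    then have "\<bar>\<delta>\<bar> \<le> err \<xi> y" using tud by simp
    also have "\<dots> \<le> \<bar>of_int u\<bar> * err \<xi> y"
      using mult_right_mono[OF u1 err_nonneg[of \<xi> y]] by simp
    finally show ?thesis .
  qed
  have y\<delta>: "\<bar>of_int (c0 y) * \<delta>\<bar> \<le> \<bar>of_int u\<bar> * err \<xi> y"
  proof -
    have "\<bar>of_int (c0 y) * \<delta>\<bar> \<le> \<bar>of_int (c0 x)\<bar> * \<bar>\<delta>\<bar>"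
      using assms(4) by (simp add: abs_mult mult_right_mono)
    also have "\<dots> = \<bar>of_int u\<bar> * (\<bar>of_int t\<bar> * \<bar>of_int u\<bar> * \<bar>\<delta>\<bar>)"
      by (simp add: x abs_mult power2_eq_square)
    also have "\<dots> \<le> \<bar>of_int u\<bar> * err \<xi> y"
      using tud by (intro mult_left_mono) auto
    finally show ?thesis .
  qed
  let ?E = "\<bar>of_int u\<bar> * err \<xi> y"
  have E0: "0 \<le> ?E" using err_nonneg by simp
  have uf: "\<bar>of_int u * f1\<bar> \<le> ?E" "\<bar>of_int u * f2\<bar> \<le> ?E"
    using f by (intro abs_mult_mono; simp)+
  define A where "A = v * c0 y - u * c1 y"
  define B where "B = v * c1 y - u * c2 y"
  have A: "\<bar>real_of_int A\<bar> \<le> (2 + 2 * \<bar>\<xi>\<bar>) * ?E"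
  proof -
    have "real_of_int A = of_int u * f1 - of_int (c0 y) * \<delta>"
      by (simp add: A_def v f algebra_simps)
    then have "\<bar>real_of_int A\<bar> \<le> 2 * ?E"
      using uf y\<delta> by linarith
    also have "\<dots> \<le> (2 + 2 * \<bar>\<xi>\<bar>) * ?E"
      using E0 by (intro mult_right_mono) auto
    finally show ?thesis .
  qed
  have B: "\<bar>real_of_int B\<bar> \<le> (2 + 2 * \<bar>\<xi>\<bar>) * ?E"
  proof -
    have "real_of_int B = of_int u * f2 - \<xi> * (of_int u * f1) - \<xi> * (of_int (c0 y) * \<delta>) + f1 * \<delta>"
      by (simp add: B_def v f algebra_simps power2_eq_square)
    also have "\<bar>\<dots>\<bar> \<le> ?E + \<bar>\<xi>\<bar> * ?E + \<bar>\<xi>\<bar> * ?E + 1 * ?E"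
      using f assms(6) by (intro order.trans[OF abs_triangle_ineq] order.trans[OF abs_triangle_ineq4]
          add_mono abs_mult_mono uf y\<delta> \<delta> order_refl) auto
    finally show ?thesis by (simp add: algebra_simps)
  qed
  have "A \<noteq> 0 \<or> B \<noteq> 0"
  proof (rule ccontr)
    assume "\<not> ?thesis"
    then have AB: "v * c0 y = u * c1 y" "v * c1 y = u * c2 y" by (auto simp: A_def B_def)
    have AB': "v * (v * c0 y) = u * (u * c2 y)" using AB by (metis mult.left_commute)
    have "wedge y x = zero3"
      using AB AB' by (simp add: wedge_def x power2_eq_square mult_ac; algebra)
    then show False using assms(3) by simp
  qed
  then have "1 \<le> \<bar>real_of_int A\<bar> \<or> 1 \<le> \<bar>real_of_int B\<bar>" by linarith
  then have "1 \<le> (2 + 2 * \<bar>\<xi>\<bar>) * ?E" using A B by linarith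
  also have "\<dots> \<le> (2 + 2 * \<bar>\<xi>\<bar>) * (\<bar>of_int (c0 x)\<bar> powr (1 / 2) * err \<xi> y)"
  proof -
    have "(real_of_int u)\<^sup>2 \<le> \<bar>of_int t\<bar> * (real_of_int u)\<^sup>2"
      using mult_right_mono[OF t1, of "(real_of_int u)\<^sup>2"] by simp
    also have "\<dots> = \<bar>of_int (c0 x)\<bar>" by (simp add: x abs_mult)
    finally have "\<bar>real_of_int u\<bar> \<le> sqrt \<bar>of_int (c0 x)\<bar>"
      by (simp add: real_le_rsqrt)
    then show ?thesis
      by (intro mult_left_mono mult_right_mono err_nonneg) (auto simp: powr_half_sqrt)
  qed
  finally show ?thesis .
qed

section \<open>Sequences of minimal points\<close>

text \<open>
  Each point after the first is a smallest one that is closer to the line than its predecessor, which is the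
  assumption \<open>minimal\<close>. The assumption \<open>decay\<close> expresses extremality, the exponent \<open>1 - golden\<close> being \<open>-1/golden\<close>.
\<close>

locale minimal_points =
  fixes \<xi> :: real and C :: real and x :: "nat \<Rightarrow> triple"
  assumes independent: "of_int a + of_int b * \<xi> + of_int c * \<xi>\<^sup>2 = 0 \<Longrightarrow> a = 0 \<and> b = 0 \<and> c = 0"
    and C_pos: "0 < C"
    and c0_ge_1: "1 \<le> \<bar>c0 (x m)\<bar>"
    and c0_less: "\<bar>c0 (x m)\<bar> < \<bar>c0 (x (Suc m))\<bar>"
    and err_le_1: "err \<xi> (x m) \<le> 1"
    and err_less: "err \<xi> (x (Suc m)) < err \<xi> (x m)"
    and minimal: "z \<noteq> zero3 \<Longrightarrow> \<bar>c0 z\<bar> < \<bar>c0 (x (Suc m))\<bar> \<Longrightarrow> err \<xi> (x m) \<le> err \<xi> z"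
    and decay: "err \<xi> (x m) \<le> C * \<bar>of_int (c0 (x (Suc m)))\<bar> powr (1 - golden)"
begin

definition X :: "nat \<Rightarrow> real" where "X m = \<bar>of_int (c0 (x m))\<bar>"
definition L :: "nat \<Rightarrow> real" where "L m = err \<xi> (x m)"
definition Q :: "nat \<Rightarrow> triple" where "Q m = wedge (x m) (x (Suc m))"

lemma X_ge_1: "1 \<le> X m"
  using c0_ge_1[of m] unfolding X_def by linarith

lemma X_pos [simp]: "0 < X m" "0 \<le> X m" "X m \<noteq> 0"
  using X_ge_1[of m] by linarith+

lemma X_less: "X m < X (Suc m)"
  using c0_less[of m] unfolding X_def by linarith

lemma X_mono: "m \<le> n \<Longrightarrow> X m \<le> X n"
  by (rule lift_Suc_mono_le[of X]) (rule less_imp_le[OF X_less])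

lemma X_ge: "real m \<le> X m"
proof (induction m)
  case (Suc m)
  then show ?case using c0_less[of m] unfolding X_def by linarith
qed simp

lemma X_at_top: "filterlim X at_top sequentially"
  by (rule filterlim_at_top_mono[OF filterlim_real_sequentially]) (simp add: X_ge)

lemma X_powr_tendsto_0: "s < 0 \<Longrightarrow> ((\<lambda>m. K * X m powr s) \<longlongrightarrow> 0) sequentially"
  by (intro tendsto_mult_right_zero tendsto_neg_powr X_at_top)

lemma L_nonneg [simp]: "0 \<le> L m"
  by (simp add: L_def err_nonneg)

lemma L_less: "m < n \<Longrightarrow> L n < L m"
  using lift_Suc_mono_less[of "\<lambda>m. - L m"] err_less by (simp add: L_def)

lemma L_antimono: "m \<le> n \<Longrightarrow> L n \<le> L m"
  using L_less[of m n] by (cases "m = n") auto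

lemma L_decay: "L m \<le> C * X (Suc m) powr (1 - golden)"
  using decay by (simp add: L_def X_def)

lemma not_parallel:
  assumes "m < n" shows "x n \<noteq> comb a (x m) 0 y"
proof
  assume eq: "x n = comb a (x m) 0 y"
  have "a \<noteq> 0" using eq c0_ge_1[of n] by (auto simp: comb_def)
  then have "1 \<le> \<bar>real_of_int a\<bar>" by linarith
  then have "L m \<le> \<bar>real_of_int a\<bar> * L m"
    using mult_right_mono[of 1 _ "L m"] by simp
  also have "\<dots> = L n"
    by (simp add: L_def eq err_scale)
  finally show False using L_less[OF assms] by linarith
qed

lemma Q_nonzero: "Q m \<noteq> zero3"
proof
  assume Q: "Q m = zero3"
  let ?p = "c0 (x m)" and ?q = "c0 (x (Suc m))"
  have parallel: "comb ?q (x m) 0 zero3 = comb ?p (x (Suc m)) 0 zero3"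
  proof -
    have "c2 (x m) * c0 (x (Suc m)) = c0 (x m) * c2 (x (Suc m))"
      "c0 (x m) * c1 (x (Suc m)) = c1 (x m) * c0 (x (Suc m))"
      using Q unfolding Q_def wedge_def by (auto simp del: mult_eq_0_iff)
    then show ?thesis by (simp add: comb_def mult.commute)
  qed
  have "\<bar>of_int ?q\<bar> * L m = \<bar>of_int ?p\<bar> * L (Suc m)"
    using arg_cong[OF parallel, of "err \<xi>"] by (simp add: err_scale L_def)
  also have "\<dots> \<le> X m * L m"
    using L_less[of m "Suc m"] by (simp add: X_def mult_left_mono)
  finally have "X (Suc m) * L m \<le> X m * L m" by (simp add: X_def)
  moreover have "0 < L m" using L_less[of m "Suc m"] L_nonneg[of "Suc m"] by linarith
  ultimately show False using c0_less[of m] by (simp add: X_def)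
qed

lemma in_plane_Q:
  assumes "pairing (Q m) z = 0"
  obtains a b where "z = comb a (x m) b (x (Suc m))"
proof (rule lattice_basis[of "x m" "x (Suc m)" z \<xi>])
  show "wedge (x m) (x (Suc m)) \<noteq> zero3" using Q_nonzero[of m] by (simp add: Q_def)
  show "pairing (wedge (x m) (x (Suc m))) z = 0" using assms by (simp add: Q_def)
  show "\<bar>c0 (x m)\<bar> < \<bar>c0 (x (Suc m))\<bar>" by (rule c0_less)
  show "err \<xi> (x (Suc m)) < err \<xi> (x m)" by (rule err_less)
  show "err \<xi> (x m) \<le> err \<xi> w" if "w \<noteq> zero3" "\<bar>c0 w\<bar> < \<bar>c0 (x (Suc m))\<bar>" for w
    using that by (rule minimal)
qed (rule that)

lemma pairing_Q [simp]: "pairing (Q m) (x m) = 0" "pairing (Q m) (x (Suc m)) = 0"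
  by (simp_all add: Q_def)

section \<open>Turns, and growth between them\<close>

text \<open>
  The indices at which the plane of two consecutive minimal points changes. The value \<open>0\<close> is
  excluded because \<open>x 0\<close> has no predecessor.
\<close>

definition turn :: "nat \<Rightarrow> bool"
  where "turn i \<longleftrightarrow> 0 < i \<and> pairing (Q (i - 1)) (x (Suc i)) \<noteq> 0"

definition consecutive :: "nat \<Rightarrow> nat \<Rightarrow> bool"
  where "consecutive i j \<longleftrightarrow> turn i \<and> turn j \<and> i < j \<and> (\<forall>k. i < k \<and> k < j \<longrightarrow> \<not> turn k)"

text \<open>
  Away from turns the next point lies in the current plane. Its coordinates in the lattice basis are
  integers, so the new form \<open>Q\<close> is an integer multiple of the old one.
\<close>

lemma plane_constant:
  assumes "i \<le> m" "\<And>k. i < k \<Longrightarrow> k \<le> m \<Longrightarrow> \<not> turn k"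
  shows "\<exists>r. r \<noteq> 0 \<and> Q m = comb r (Q i) 0 zero3"
  using assms
proof (induction m rule: dec_induct)
  case base
  show ?case by (rule exI[of _ 1], cases "Q i") (simp add: comb_def)
next
  case (step m)
  obtain r where r: "r \<noteq> 0" "Q m = comb r (Q i) 0 zero3"
    using step.IH step.prems by (meson le_SucI)
  have "\<not> turn (Suc m)" using step by auto
  then have "pairing (Q m) (x (Suc (Suc m))) = 0" by (simp add: turn_def)
  then obtain a b where ab: "x (Suc (Suc m)) = comb a (x m) b (x (Suc m))"
    by (rule in_plane_Q)
  have "a \<noteq> 0"
  proof
    assume "a = 0"
    then have "x (Suc (Suc m)) = comb b (x (Suc m)) 0 zero3"
      using ab by (simp add: comb_def)
    then show False using not_parallel[of "Suc m" "Suc (Suc m)" b] by (simp add: comb_def)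
  qed
  moreover have "Q (Suc m) = comb (- a) (Q m) 0 zero3"
    by (simp add: Q_def ab wedge_def comb_def algebra_simps)
  ultimately show ?case
    using r by (intro exI[of _ "- a * r"]) (simp add: comb_def)
qed

lemma pairing_scaled: "pairing (comb r q 0 w) z = r * pairing q z"
  by (simp add: pairing_def comb_def algebra_simps)

lemma quad_scaled: "quad \<xi> (comb r q 0 w) = of_int r * quad \<xi> q"
  by (simp add: quad_def comb_def algebra_simps)

text \<open>
  Otherwise almost all minimal points lie in a fixed rational plane. As they converge in direction to
  \<open>(1, \<xi>, \<xi>\<^sup>2)\<close>, the plane contains this vector, contradicting the independence of \<open>1\<close>, \<open>\<xi>\<close>, \<open>\<xi>\<^sup>2\<close>.
\<close>

lemma infinitely_many_turns: "\<exists>i\<ge>n. turn i"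
proof (rule ccontr)
  assume no: "\<not> ?thesis"
  have on_plane: "pairing (Q n) (x m) = 0" if "n \<le> m" for m
  proof -
    obtain r where r: "r \<noteq> 0" "Q m = comb r (Q n) 0 zero3"
      using plane_constant[OF \<open>n \<le> m\<close>] no by (metis less_imp_le)
    then have "r * pairing (Q n) (x m) = 0"
      using pairing_Q(1)[of m] by (simp add: pairing_scaled)
    then show ?thesis using r by simp
  qed
  have "\<bar>quad \<xi> (Q n)\<bar> \<le> size1 (Q n) * C * X (Suc m) powr (1 - golden)" if "n \<le> m" for m
  proof -
    have "1 * \<bar>quad \<xi> (Q n)\<bar> \<le> X m * \<bar>quad \<xi> (Q n)\<bar>"
      by (intro mult_right_mono X_ge_1) simp
    also have "\<dots> \<le> size1 (Q n) * L m"
      using pairing_approx[of "Q n" "x m" \<xi>] on_plane[OF that] by (simp add: X_def L_def abs_mult)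
    also have "\<dots> \<le> size1 (Q n) * (C * X (Suc m) powr (1 - golden))"
      by (intro mult_left_mono L_decay) (simp add: size1_def)
    finally show ?thesis by simp
  qed
  then have "\<bar>quad \<xi> (Q n)\<bar> \<le> 0"
    using golden_bounds
    by (intro tendsto_lowerbound[OF filterlim_compose[OF X_powr_tendsto_0 filterlim_Suc]]
        eventually_sequentiallyI[of n]) auto
  then have "quad \<xi> (Q n) = 0" by simp
  then have "Q n = zero3"
    using independent[of "c0 (Q n)" "c1 (Q n)" "c2 (Q n)"] by (cases "Q n") (auto simp: quad_def)
  then show False using Q_nonzero by blast
qed

text \<open>
  By \<open>disc_zero_bound\<close> with the preceding minimal point, a zero would bound \<open>X m powr (3/2 - \<gamma>)\<close> from
  below, but the exponent is negative.
\<close>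

lemma disc_nonzero: "\<exists>n. \<forall>m\<ge>n. disc (x m) \<noteq> 0"
proof -
  have "\<forall>\<^sub>F m in sequentially. (2 + 2 * \<bar>\<xi>\<bar>) * C * X m powr (3 / 2 - golden) < 1"
    by (rule order_tendstoD(2)[OF X_powr_tendsto_0]) (use golden_bounds in auto)
  then obtain n where n: "\<And>m. n \<le> m \<Longrightarrow> (2 + 2 * \<bar>\<xi>\<bar>) * C * X m powr (3 / 2 - golden) < 1"
    by (auto simp: eventually_sequentially)
  have "disc (x m) \<noteq> 0" if m: "Suc n \<le> m" for m
  proof
    assume disc: "disc (x m) = 0"
    obtain k where k: "m = Suc k" using m by (cases m) auto
    have "1 \<le> (2 + 2 * \<bar>\<xi>\<bar>) * (X m powr (1 / 2) * L k)"
      using disc_zero_bound[OF disc c0_ge_1, of "x k" \<xi>] Q_nonzero[of k] c0_less[of k] err_less[of k]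
        err_le_1[of k] unfolding X_def L_def k Q_def by simp
    also have "\<dots> \<le> (2 + 2 * \<bar>\<xi>\<bar>) * (X m powr (1 / 2) * (C * X m powr (1 - golden)))"
      unfolding k by (intro mult_left_mono L_decay) auto
    also have "\<dots> = (2 + 2 * \<bar>\<xi>\<bar>) * C * X m powr (3 / 2 - golden)"
      by (simp flip: powr_add)
    also have "\<dots> < 1" using n m by simp
    finally show False by simp
  qed
  then show ?thesis by blast
qed

text \<open>
  The integer \<open>disc (x i)\<close> is nonzero but \<open>O(X i * L i)\<close>, so \<open>x i\<close> is not too close to the line; \<open>decay\<close>
  turns this into a bound for the next size.
\<close>

lemma X_Suc_le: "\<exists>K>0. \<exists>n. \<forall>i\<ge>n. X (Suc i) \<le> K * X i powr golden"
proof -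
  obtain n where n: "\<And>i. n \<le> i \<Longrightarrow> disc (x i) \<noteq> 0" using disc_nonzero by blast
  define K where "K = (2 + 2 * \<bar>\<xi>\<bar>) * C"
  have K: "0 < K" using C_pos by (simp add: K_def add_pos_nonneg)
  have "X (Suc i) \<le> K powr golden * X i powr golden" if "n \<le> i" for i
  proof -
    have "1 \<le> \<bar>real_of_int (disc (x i))\<bar>" using n[OF that] by linarith
    also have "\<dots> \<le> (2 + 2 * \<bar>\<xi>\<bar>) * (X i * L i)"
      using disc_bound[OF err_le_1 c0_ge_1] by (simp add: X_def L_def)
    also have "\<dots> \<le> (2 + 2 * \<bar>\<xi>\<bar>) * (X i * (C * X (Suc i) powr (1 - golden)))"
      by (intro mult_left_mono L_decay) (auto intro: less_imp_le)
    finally have "1 \<le> K * X i * X (Suc i) powr (1 - golden)" by (simp add: K_def mult_ac)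
    then have "1 * X (Suc i) powr (golden - 1)
        \<le> K * X i * X (Suc i) powr (1 - golden) * X (Suc i) powr (golden - 1)"
      by (rule mult_right_mono) simp
    then have "X (Suc i) powr (golden - 1) \<le> K * X i powr 1"
      by (simp add: mult.assoc flip: powr_add)
    then have "X (Suc i) powr ((golden - 1) * golden) \<le> K powr golden * X i powr (1 * golden)"
      using K golden_bounds by (intro powr_raise) auto
    also have "(golden - 1) * golden = 1" using golden_sq by (simp add: algebra_simps)
    finally show ?thesis by (simp add: less_imp_le)
  qed
  then show ?thesis using K by (intro exI[of _ "K powr golden"]) auto
qed

lemma size1_Q: "size1 (Q m) \<le> (6 + 2 * \<bar>\<xi>\<bar> + 2 * \<xi>\<^sup>2) * (X (Suc m) * L m)"
  unfolding Q_def X_def L_def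
  using c0_less[of m] err_less[of m] by (intro size1_wedge err_le_1 c0_ge_1) auto

text \<open>
  At a turn the determinant of three consecutive points is a nonzero integer, but it is
  \<open>O(X (Suc i) * L (i - 1) * L i)\<close>. With \<open>decay\<close> this makes \<open>X (Suc i)\<close> large.
\<close>

lemma X_powr_le_turn: "\<exists>K>0. \<forall>i. turn i \<longrightarrow> X i powr golden \<le> K * X (Suc i)"
proof -
  define M where "M = 8 + 2 * \<bar>\<xi>\<bar> + 2 * \<xi>\<^sup>2"
  have M: "0 < M" by (simp add: M_def add_pos_nonneg)
  define K where "K = M * C\<^sup>2"
  have K: "0 < K" using C_pos M by (simp add: K_def)
  have "X i powr golden \<le> K powr (golden + 1) * X (Suc i)" if i: "turn i" for i
  proof -
    obtain h where h: "i = Suc h" and nz: "pairing (Q h) (x (Suc i)) \<noteq> 0"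
      using i by (cases i) (auto simp: turn_def)
    have M2: "6 + 2 * \<bar>\<xi>\<bar> + 2 * \<xi>\<^sup>2 = M - 2" "0 \<le> M - 2"
      by (simp_all add: M_def)
    have "1 \<le> \<bar>real_of_int (pairing (Q h) (x (Suc i)))\<bar>" using nz by linarith
    also have "\<dots> \<le> \<bar>of_int (c0 (x (Suc i))) * quad \<xi> (Q h)\<bar> + size1 (Q h) * L (Suc i)"
      using pairing_approx[of "Q h" "x (Suc i)" \<xi>] unfolding L_def by linarith
    also have "\<dots> = X (Suc i) * \<bar>quad \<xi> (Q h)\<bar> + size1 (Q h) * L (Suc i)"
      by (simp add: X_def abs_mult)
    also have "\<dots> \<le> X (Suc i) * (2 * L h * L i) + ((M - 2) * (X i * L h)) * L (Suc i)"
      using size1_Q[of h] quad_wedge[of \<xi> "x h" "x i"] unfolding M2 h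
      by (intro add_mono mult_left_mono mult_right_mono) (simp_all add: L_def Q_def err_nonneg)
    also have "\<dots> \<le> X (Suc i) * (2 * L h * L i) + (M - 2) * (X (Suc i) * L h) * L i"
    proof -
      have "X i * L h * L (Suc i) \<le> X (Suc i) * L h * L i"
        using X_mono[of i "Suc i"] L_antimono[of i "Suc i"]
        by (intro mult_mono) simp_all
      from mult_left_mono[OF this M2(2)] show ?thesis by (simp only: mult.assoc add_left_mono)
    qed
    also have "\<dots> = M * X (Suc i) * (L h * L i)" by (simp add: algebra_simps)
    also have "\<dots> \<le> M * X (Suc i) * ((C * X i powr (1 - golden)) * (C * X (Suc i) powr (1 - golden)))"
      using M C_pos L_decay[of h] L_decay[of i] unfolding h
      by (intro mult_left_mono mult_mono) (auto intro: less_imp_le)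
    also have "\<dots> = K * (X (Suc i) powr 1 * X (Suc i) powr (1 - golden)) * X i powr (1 - golden)"
      by (simp add: K_def power2_eq_square)
    also have "\<dots> = K * X (Suc i) powr (2 - golden) * X i powr (1 - golden)"
      by (subst powr_add[symmetric]) simp
    finally have "1 * X i powr (golden - 1)
        \<le> K * X (Suc i) powr (2 - golden) * X i powr (1 - golden) * X i powr (golden - 1)"
      by (rule mult_right_mono) simp
    then have "X i powr (golden - 1) \<le> K * X (Suc i) powr (2 - golden)"
      by (simp add: mult.assoc flip: powr_add)
    then have "X i powr ((golden - 1) * (golden + 1))
        \<le> K powr (golden + 1) * X (Suc i) powr ((2 - golden) * (golden + 1))"
      using K golden_bounds by (intro powr_raise) auto
    also have "(golden - 1) * (golden + 1) = golden" using golden_sq by (simp add: algebra_simps)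
    also have "(2 - golden) * (golden + 1) = 1" using golden_sq by (simp add: algebra_simps)
    finally show ?thesis by (simp add: less_imp_le)
  qed
  then show ?thesis using K by (intro exI[of _ "K powr (golden + 1)"]) auto
qed

text \<open>
  The gain from turns: the error at \<open>x i\<close> is \<open>O(1 / X i)\<close>, whereas in general \<open>decay\<close> and the monotonicity
  of sizes only give the exponent \<open>1 - \<gamma>\<close>.
\<close>

lemma L_turn: "\<exists>K>0. \<forall>i. turn i \<longrightarrow> X i * L i \<le> K"
proof -
  obtain M where M: "0 < M" "\<And>i. turn i \<Longrightarrow> X i powr golden \<le> M * X (Suc i)"
    using X_powr_le_turn by blast
  have "X i * L i \<le> C * M powr (golden - 1)" if "turn i" for i
  proof -
    have "X i powr (golden * (golden - 1)) \<le> M powr (golden - 1) * X (Suc i) powr (1 * (golden - 1))"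
      using M that golden_bounds by (intro powr_raise) auto
    also have "golden * (golden - 1) = 1" using golden_sq by (simp add: algebra_simps)
    finally have "X i \<le> M powr (golden - 1) * X (Suc i) powr (golden - 1)" by simp
    then have "X i * L i \<le> (M powr (golden - 1) * X (Suc i) powr (golden - 1))
        * (C * X (Suc i) powr (1 - golden))"
      using M L_decay[of i] by (intro mult_mono) auto
    also have "\<dots> = C * M powr (golden - 1) * (X (Suc i) powr (golden - 1) * X (Suc i) powr (1 - golden))"
      by simp
    also have "\<dots> = C * M powr (golden - 1)" by (subst powr_add[symmetric]) simp
    finally show ?thesis .
  qed
  then show ?thesis using M C_pos by (intro exI[of _ "C * M powr (golden - 1)"]) auto
qed

lemma size1_Q_powr: "\<exists>K>0. \<exists>n. \<forall>i\<ge>n. size1 (Q i) \<le> K * X i powr (golden - 1)"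
proof -
  obtain M n where M: "0 < M" "\<And>i. n \<le> i \<Longrightarrow> X (Suc i) \<le> M * X i powr golden"
    using X_Suc_le by blast
  define B where "B = 6 + 2 * \<bar>\<xi>\<bar> + 2 * \<xi>\<^sup>2"
  have B: "0 < B" by (simp add: B_def add_pos_nonneg)
  have "size1 (Q i) \<le> (B * C * M powr (2 - golden)) * X i powr (golden - 1)" if "n \<le> i" for i
  proof -
    have "X (Suc i) powr (1 * (2 - golden)) \<le> M powr (2 - golden) * X i powr (golden * (2 - golden))"
      using M that golden_bounds by (intro powr_raise) auto
    moreover have "golden * (2 - golden) = golden - 1" using golden_sq by (simp add: algebra_simps)
    ultimately have upper: "X (Suc i) powr (2 - golden) \<le> M powr (2 - golden) * X i powr (golden - 1)"
      by simp
    have "size1 (Q i) \<le> B * (X (Suc i) * L i)" using size1_Q by (simp add: B_def)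
    also have "\<dots> \<le> B * (X (Suc i) powr 1 * (C * X (Suc i) powr (1 - golden)))"
      using B L_decay[of i] by (intro mult_left_mono) auto
    also have "\<dots> = B * C * (X (Suc i) powr 1 * X (Suc i) powr (1 - golden))" by simp
    also have "\<dots> = B * C * X (Suc i) powr (2 - golden)" by (subst powr_add[symmetric]) simp
    also have "\<dots> \<le> B * C * (M powr (2 - golden) * X i powr (golden - 1))"
      using B C_pos upper by (intro mult_left_mono) auto
    finally show ?thesis by simp
  qed
  then show ?thesis using M B C_pos by (intro exI[of _ "B * C * M powr (2 - golden)"]) auto
qed

lemma Q_consecutive:
  assumes "consecutive i j"
  obtains r where "r \<noteq> 0" "Q (j - 1) = comb r (Q i) 0 zero3"
  using plane_constant[of i "j - 1"] assms unfolding consecutive_def by fastforce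

text \<open>
  The form at \<open>j - 1\<close> is a nonzero integer multiple of \<open>Q i\<close>, so the smaller errors available just before
  the next turn also bound the value of \<open>Q i\<close>.
\<close>

lemma quad_Q_consecutive:
  assumes "consecutive i j"
  shows "\<bar>quad \<xi> (Q i)\<bar> \<le> 2 * L (j - 1) * L j"
proof -
  obtain r where r: "r \<noteq> 0" "Q (j - 1) = comb r (Q i) 0 zero3"
    using assms by (rule Q_consecutive)
  have "1 * \<bar>quad \<xi> (Q i)\<bar> \<le> \<bar>of_int r\<bar> * \<bar>quad \<xi> (Q i)\<bar>"
    using r(1) by (intro mult_right_mono) auto
  also have "\<dots> = \<bar>quad \<xi> (Q (j - 1))\<bar>"
    unfolding r(2) quad_scaled by (simp add: abs_mult)
  also have "\<dots> \<le> 2 * L (j - 1) * L j"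
    using assms quad_wedge[of \<xi> "x (j - 1)" "x j"] by (simp add: Q_def L_def consecutive_def)
  finally show ?thesis by simp
qed

lemma pairing_Q_consecutive_eq_0_iff:
  assumes "consecutive i j"
  shows "pairing (Q (j - 1)) z = 0 \<longleftrightarrow> pairing (Q i) z = 0"
proof -
  obtain r where "r \<noteq> 0" "Q (j - 1) = comb r (Q i) 0 zero3"
    using assms by (rule Q_consecutive)
  then show ?thesis by (simp add: pairing_scaled)
qed

lemma pairing_Q_pred: "0 < j \<Longrightarrow> pairing (Q (j - 1)) (x j) = 0"
  using pairing_Q(2)[of "j - 1"] by simp

text \<open>
  The key estimate. The point \<open>w\<close> obtained by reflecting \<open>x (Suc j)\<close> in \<open>x j\<close> is a combination of these two,
  and only the second leaves the plane of \<open>Q i\<close>, so \<open>Q i\<close> takes the nonzero integer value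
  \<open>- disc (x j) * pairing (Q i) (x (Suc j))\<close> at \<open>w\<close>. On the other hand \<open>w\<close> has size \<open>O(X j)\<close> and error
  \<open>O(X j powr (\<gamma> - 2))\<close>. The size contributes less than \<open>1/2\<close> to this value because \<open>Q i\<close> is tiny at \<open>(1, \<xi>, \<xi>\<^sup>2)\<close>,
  so \<open>size1 (Q i) = O(X i powr (\<gamma> - 1))\<close> times the error is at least \<open>1/2\<close>. This bounds \<open>X j\<close>.
\<close>

lemma X_consecutive_le:
  "\<exists>K>0. \<exists>n. \<forall>i\<ge>n. \<forall>j. consecutive i j \<longrightarrow> X j \<le> K * X i powr golden"
proof -
  obtain a n1 where a: "0 < a" "\<And>i. n1 \<le> i \<Longrightarrow> X (Suc i) \<le> a * X i powr golden"
    using X_Suc_le by blast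
  obtain b where b: "0 < b" "\<And>i. turn i \<Longrightarrow> X i * L i \<le> b"
    using L_turn by blast
  obtain c n2 where c: "0 < c" "\<And>i. n2 \<le> i \<Longrightarrow> size1 (Q i) \<le> c * X i powr (golden - 1)"
    using size1_Q_powr by blast
  obtain n3 where n3: "\<And>i. n3 \<le> i \<Longrightarrow> disc (x i) \<noteq> 0"
    using disc_nonzero by blast
  define R where "R = 5 + 4 * \<bar>\<xi>\<bar>"
  have R: "0 < R" by (simp add: R_def add_pos_nonneg)
  define M where "M = R * (b + a * b\<^sup>2) * (2 * C * b)"
  have "\<forall>\<^sub>F m in sequentially. M * X m powr (1 - golden) < 1 / 2"
    by (rule order_tendstoD(2)[OF X_powr_tendsto_0]) (use golden_bounds in auto)
  then obtain n4 where n4: "\<And>m. n4 \<le> m \<Longrightarrow> M * X m powr (1 - golden) < 1 / 2"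
    by (auto simp: eventually_sequentially)
  define N where "N = 2 * c * R * (b\<^sup>2 + a * b\<^sup>2)"
  have N: "0 < N" using a b c R by (simp add: N_def add_pos_pos)
  have "X j \<le> N powr (golden + 1) * X i powr golden"
    if i: "max (max n1 n2) (max n3 n4) \<le> i" and ij: "consecutive i j" for i j
  proof -
    have j: "i < j" "turn j" "0 < j" using ij by (auto simp: consecutive_def)
    have XL: "X j * L j \<le> b" using b j by blast
    have XL2: "(X j)\<^sup>2 * (L j)\<^sup>2 \<le> b\<^sup>2"
      using power_mono[OF XL, of 2] by (simp add: power_mult_distrib)
    have XSuc: "X (Suc j) * (L j)\<^sup>2 \<le> a * b\<^sup>2 * X j powr (golden - 2)"
    proof -
      have "X (Suc j) * (L j)\<^sup>2 \<le> a * X j powr golden * (L j)\<^sup>2"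
        using a i j by (intro mult_right_mono) auto
      also have "X j powr golden = X j powr (golden - 2) * X j powr 2"
        by (subst powr_add[symmetric]) simp
      also have "a * (X j powr (golden - 2) * X j powr 2) * (L j)\<^sup>2
          = a * X j powr (golden - 2) * ((X j)\<^sup>2 * (L j)\<^sup>2)"
        by simp
      also have "\<dots> \<le> a * X j powr (golden - 2) * b\<^sup>2"
        using a XL2 by (intro mult_left_mono) auto
      finally show ?thesis by (simp add: mult_ac)
    qed
    define w where "w = reflect (x j) (x (Suc j))"
    have w0: "\<bar>of_int (c0 w)\<bar> \<le> R * (b + a * b\<^sup>2) * X j"
    proof -
      have "\<bar>of_int (c0 w)\<bar> \<le> R * ((X j)\<^sup>2 * L (Suc j) + X (Suc j) * (L j)\<^sup>2)"
        unfolding w_def R_def X_def L_def by (intro reflect_bounds err_le_1 c0_ge_1)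
      also have "\<dots> \<le> R * (b * X j + a * b\<^sup>2 * X j)"
      proof (intro mult_left_mono add_mono)
        have "(X j)\<^sup>2 * L (Suc j) \<le> (X j)\<^sup>2 * L j"
          using L_less[of j "Suc j"] by (intro mult_left_mono) auto
        also have "\<dots> = X j * L j * X j" by (simp add: power2_eq_square)
        also have "\<dots> \<le> b * X j" using XL by (intro mult_right_mono) auto
        finally show "(X j)\<^sup>2 * L (Suc j) \<le> b * X j" .
        have "X j powr (golden - 2) \<le> X j powr 1"
          using X_ge_1[of j] golden_bounds by (intro powr_mono) auto
        then have "a * b\<^sup>2 * X j powr (golden - 2) \<le> a * b\<^sup>2 * X j"
          using a by (intro mult_left_mono) auto
        then show "X (Suc j) * (L j)\<^sup>2 \<le> a * b\<^sup>2 * X j" using XSuc by simp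
      qed (use R in simp)
      finally show ?thesis by (simp add: algebra_simps)
    qed
    have errw: "err \<xi> w \<le> R * (b\<^sup>2 + a * b\<^sup>2) * X j powr (golden - 2)"
    proof -
      have "err \<xi> w \<le> R * (X j * L j * L (Suc j) + X (Suc j) * (L j)\<^sup>2)"
        unfolding w_def R_def X_def L_def by (intro reflect_bounds err_le_1 c0_ge_1)
      also have "\<dots> \<le> R * (b\<^sup>2 * X j powr (golden - 2) + a * b\<^sup>2 * X j powr (golden - 2))"
      proof (intro mult_left_mono add_mono XSuc)
        have "X j powr 1 * (X j * L j * L (Suc j)) \<le> X j * (X j * L j * L j)"
          using L_less[of j "Suc j"] by (auto intro!: mult_left_mono)
        also have "\<dots> = (X j)\<^sup>2 * (L j)\<^sup>2" by (simp add: power2_eq_square)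
        also have "\<dots> \<le> b\<^sup>2" by (rule XL2)
        finally have "X j powr - 1 * (X j powr 1 * (X j * L j * L (Suc j))) \<le> X j powr - 1 * b\<^sup>2"
          by (rule mult_left_mono) simp
        also have "X j powr - 1 * (X j powr 1 * (X j * L j * L (Suc j))) = X j * L j * L (Suc j)"
          unfolding mult.assoc[symmetric] by (subst powr_add[symmetric]) simp
        also have "X j powr - 1 * b\<^sup>2 \<le> X j powr (golden - 2) * b\<^sup>2"
          using X_ge_1[of j] golden_bounds by (intro mult_right_mono powr_mono) auto
        finally show "X j * L j * L (Suc j) \<le> b\<^sup>2 * X j powr (golden - 2)"
          by (simp add: mult.commute)
      qed (use R in simp)
      finally show ?thesis by (simp add: algebra_simps)
    qed
    have "pairing (Q i) (x j) = 0"
      using pairing_Q_consecutive_eq_0_iff[OF ij] pairing_Q_pred[OF j(3)] by blast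
    moreover have "pairing (Q i) (x (Suc j)) \<noteq> 0"
      using pairing_Q_consecutive_eq_0_iff[OF ij] j(2) unfolding turn_def by blast
    moreover have "disc (x j) \<noteq> 0"
      using n3[of j] i j by simp
    ultimately have "pairing (Q i) w \<noteq> 0"
      by (simp add: w_def reflect_def pairing_comb)
    then have "1 \<le> \<bar>real_of_int (pairing (Q i) w)\<bar>" by linarith
    also have "\<dots> \<le> \<bar>of_int (c0 w) * quad \<xi> (Q i)\<bar> + size1 (Q i) * err \<xi> w"
      using pairing_approx[of "Q i" w \<xi>] by linarith
    finally have one_le: "1 \<le> \<bar>of_int (c0 w) * quad \<xi> (Q i)\<bar> + size1 (Q i) * err \<xi> w" .
    have "\<bar>of_int (c0 w) * quad \<xi> (Q i)\<bar> \<le> (R * (b + a * b\<^sup>2) * X j) * (2 * L (j - 1) * L j)"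
      by (rule abs_mult_mono[OF w0 quad_Q_consecutive[OF ij]])
    also have "\<dots> = R * (b + a * b\<^sup>2) * 2 * (L (j - 1) * (X j * L j))" by simp
    also have "\<dots> \<le> R * (b + a * b\<^sup>2) * 2 * ((C * X j powr (1 - golden)) * b)"
    proof (rule mult_left_mono)
      show "L (j - 1) * (X j * L j) \<le> (C * X j powr (1 - golden)) * b"
        using L_decay[of "j - 1"] j XL C_pos by (intro mult_mono) auto
      show "0 \<le> R * (b + a * b\<^sup>2) * 2" using R a b by simp
    qed
    also have "\<dots> = M * X j powr (1 - golden)" by (simp add: M_def)
    also have "\<dots> < 1 / 2" using n4[of j] i j by simp
    finally have first: "\<bar>of_int (c0 w) * quad \<xi> (Q i)\<bar> < 1 / 2" .
    have "size1 (Q i) * err \<xi> w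
        \<le> (c * X i powr (golden - 1)) * (R * (b\<^sup>2 + a * b\<^sup>2) * X j powr (golden - 2))"
      using c(2)[of i] c(1) i by (intro mult_mono errw) (auto simp: err_nonneg)
    also have "\<dots> = N / 2 * X i powr (golden - 1) * X j powr (golden - 2)"
      by (simp add: N_def)
    finally have "1 \<le> N * X i powr (golden - 1) * X j powr (golden - 2)"
      using one_le first by simp
    then have "1 * X j powr (2 - golden)
        \<le> N * X i powr (golden - 1) * X j powr (golden - 2) * X j powr (2 - golden)"
      by (rule mult_right_mono) simp
    also have "\<dots> = N * X i powr (golden - 1)"
      unfolding mult.assoc by (subst powr_add[symmetric]) simp
    finally have "X j powr (2 - golden) \<le> N * X i powr (golden - 1)" by simp
    then have "X j powr ((2 - golden) * (golden + 1))
        \<le> N powr (golden + 1) * X i powr ((golden - 1) * (golden + 1))"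
      using N golden_bounds by (intro powr_raise) auto
    moreover have "(golden - 1) * (golden + 1) = golden" "(2 - golden) * (golden + 1) = 1"
      using golden_sq by (simp_all add: algebra_simps)
    ultimately show ?thesis by simp
  qed
  then show ?thesis using N
    by (intro exI[of _ "N powr (golden + 1)"] conjI exI[of _ "max (max n1 n2) (max n3 n4)"]) auto
qed

lemma consecutive_before:
  assumes "turn k" "k < j" "turn j"
  obtains i where "k \<le> i" "consecutive i j"
proof -
  define S where "S = {i. turn i \<and> i < j}"
  have S: "finite S" "k \<in> S" using assms by (auto simp: S_def)
  define i where "i = Max S"
  have "i \<in> S" unfolding i_def using S by (intro Max_in) auto
  moreover have max: "l \<le> i" if "l \<in> S" for l
    unfolding i_def using S that by (intro Max_ge) auto
  ultimately have "consecutive i j"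
    using assms max unfolding consecutive_def S_def by (auto simp: not_le[symmetric])
  then show ?thesis using that max S by blast
qed

text \<open>
  For consecutive turns \<open>g < h < i\<close> the sizes are of order \<open>X\<close>, \<open>X powr \<gamma>\<close>, \<open>X powr \<gamma>\<^sup>2\<close>; the form \<open>Q g\<close> has
  size \<open>O(X powr (\<gamma> - 1))\<close>, which is of the order of the \<open>(2 \<gamma> - 3)\<close>-th power of the size of \<open>x i\<close>. It does not
  vanish at \<open>x i\<close>, since its kernel meets the plane spanned by \<open>x h\<close> and \<open>x i\<close> only in the line through \<open>x h\<close>.
\<close>

lemma points_and_forms:
  "\<exists>K>0. \<exists>Z0. \<forall>Z\<ge>Z0. \<exists>z q. Z \<le> \<bar>of_int (c0 z)\<bar> \<and> \<bar>of_int (c0 z)\<bar> \<le> K * Z powr golden \<and>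
     \<bar>of_int (c0 z)\<bar> * err \<xi> z \<le> K \<and> size1 q \<le> K * \<bar>of_int (c0 z)\<bar> powr (2 * golden - 3) \<and>
     pairing q z \<noteq> 0 \<and> \<bar>of_int (pairing q z)\<bar> \<le> K"
proof -
  obtain a n1 where a: "0 < a"
    "\<And>i j. n1 \<le> i \<Longrightarrow> consecutive i j \<Longrightarrow> X j \<le> a * X i powr golden"
    using X_consecutive_le by blast
  obtain b where b: "0 < b" "\<And>i. turn i \<Longrightarrow> X i * L i \<le> b"
    using L_turn by blast
  obtain c n2 where c: "0 < c" "\<And>i. n2 \<le> i \<Longrightarrow> size1 (Q i) \<le> c * X i powr (golden - 1)"
    using size1_Q_powr by blast
  obtain d where d: "0 < d" "\<And>i. turn i \<Longrightarrow> X i powr golden \<le> d * X (Suc i)"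
    using X_powr_le_turn by blast
  have d': "X i powr golden \<le> d * X j" if "consecutive i j" for i j
  proof -
    have "d * X (Suc i) \<le> d * X j"
      using d that X_mono[of "Suc i" j] by (auto simp: consecutive_def)
    then show ?thesis using d(2)[of i] that by (auto simp: consecutive_def)
  qed
  \<comment> \<open>two turns in reserve, so that the turn found below has two predecessors beyond all thresholds\<close>
  obtain t0 where t0: "max n1 n2 \<le> t0" "turn t0" using infinitely_many_turns by blast
  obtain t1 where t1: "Suc t0 \<le> t1" "turn t1" using infinitely_many_turns by blast
  define K where "K = Max {a, b, c * d powr (2 - golden) * d powr (2 * golden - 3), 2 * C * a * b + c * b}"
  have K: "a \<le> K" "b \<le> K" "c * d powr (2 - golden) * d powr (2 * golden - 3) \<le> K"
    "2 * C * a * b + c * b \<le> K"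
    unfolding K_def by (intro Max_ge; simp)+
  have "\<exists>z q. Z \<le> \<bar>of_int (c0 z)\<bar> \<and> \<bar>of_int (c0 z)\<bar> \<le> K * Z powr golden \<and>
     \<bar>of_int (c0 z)\<bar> * err \<xi> z \<le> K \<and> size1 q \<le> K * \<bar>of_int (c0 z)\<bar> powr (2 * golden - 3) \<and>
     pairing q z \<noteq> 0 \<and> \<bar>of_int (pairing q z)\<bar> \<le> K" if Z: "X t1 + 1 \<le> Z" for Z
  proof -
    define P where "P i \<longleftrightarrow> turn i \<and> Z \<le> X i" for i
    obtain i0 where "nat \<lceil>Z\<rceil> \<le> i0" "turn i0" using infinitely_many_turns by blast
    then have "P i0" using X_ge[of i0] unfolding P_def by linarith
    define i where "i = (LEAST i. P i)"
    have i: "turn i" "Z \<le> X i" using LeastI[of P, OF \<open>P i0\<close>] by (auto simp: i_def P_def)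
    have "t1 < i" using X_mono[of i t1] i Z by (intro not_le_imp_less notI) linarith
    then obtain h where h: "t1 \<le> h" "consecutive h i"
      using consecutive_before t1 i by metis
    have hi: "turn h" "h < i" using h by (auto simp: consecutive_def)
    have "\<not> P h" using hi not_less_Least[of h P] by (simp add: i_def)
    then have XhZ: "X h \<le> Z" using hi by (simp add: P_def)
    obtain g where g: "t0 \<le> g" "consecutive g h"
      using consecutive_before[of t0 h] t0 t1 h hi by force
    have gh: "g < h" "0 < h" using g by (auto simp: consecutive_def)
    have Xi: "X i \<le> a * X h powr golden"
      using a h t0 t1 by auto
    have upper: "X i \<le> K * Z powr golden"
      using Xi K(1) XhZ a golden_bounds
      by (elim order.trans, intro mult_mono powr_mono2) auto
    have XLi: "X i * L i \<le> b" using b i by blast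
    have sizeQ: "size1 (Q g) \<le> c * X g powr (golden - 1)"
      using c g t0 by auto
    have size: "size1 (Q g) \<le> K * X i powr (2 * golden - 3)"
    proof -
      have "X g powr (golden * (2 - golden)) \<le> d powr (2 - golden) * X h powr (1 * (2 - golden))"
        using d'[OF g(2)] d golden_bounds by (intro powr_raise) auto
      also have "golden * (2 - golden) = golden - 1" using golden_sq by (simp add: algebra_simps)
      finally have 1: "X g powr (golden - 1) \<le> d powr (2 - golden) * X h powr (2 - golden)" by simp
      have "X h powr (golden * (2 * golden - 3))
          \<le> d powr (2 * golden - 3) * X i powr (1 * (2 * golden - 3))"
        using d'[OF h(2)] d golden_bounds by (intro powr_raise) auto
      also have "golden * (2 * golden - 3) = 2 - golden" using golden_sq by (simp add: algebra_simps)
      finally have 2: "X h powr (2 - golden) \<le> d powr (2 * golden - 3) * X i powr (2 * golden - 3)"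
        by simp
      have "size1 (Q g) \<le> c * (d powr (2 - golden) * (d powr (2 * golden - 3) * X i powr (2 * golden - 3)))"
        using c(1) by (intro order.trans[OF sizeQ] mult_left_mono order.trans[OF 1] 2) auto
      also have "\<dots> = (c * d powr (2 - golden) * d powr (2 * golden - 3)) * X i powr (2 * golden - 3)"
        by simp
      also have "\<dots> \<le> K * X i powr (2 * golden - 3)"
        using K(3) by (intro mult_right_mono) auto
      finally show ?thesis .
    qed
    have nonzero: "pairing (Q g) (x i) \<noteq> 0"
    proof -
      have "pairing (Q h) (x i) = 0"
        using pairing_Q_consecutive_eq_0_iff[OF h(2)] pairing_Q_pred[of i] hi by simp
      then obtain u v where uv: "x i = comb u (x h) v (x (Suc h))" by (rule in_plane_Q)
      have "v \<noteq> 0"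
        using uv not_parallel[OF hi(2), of u zero3] by (auto simp: comb_def)
      moreover have "pairing (Q (h - 1)) (x h) = 0" "pairing (Q (h - 1)) (x (Suc h)) \<noteq> 0"
        using pairing_Q_pred[OF gh(2)] hi(1) unfolding turn_def by blast+
      ultimately have "pairing (Q (h - 1)) (x i) \<noteq> 0"
        unfolding uv pairing_comb by simp
      then show ?thesis using pairing_Q_consecutive_eq_0_iff[OF g(2)] by blast
    qed
    have bounded: "\<bar>of_int (pairing (Q g) (x i))\<bar> \<le> K"
    proof -
      have "\<bar>of_int (pairing (Q g) (x i))\<bar> \<le> \<bar>of_int (c0 (x i)) * quad \<xi> (Q g)\<bar> + size1 (Q g) * L i"
        using pairing_approx[of "Q g" "x i" \<xi>] unfolding L_def by linarith
      also have "\<dots> = X i * \<bar>quad \<xi> (Q g)\<bar> + size1 (Q g) * L i"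
        by (simp add: X_def abs_mult)
      also have "\<dots> \<le> 2 * C * a * b + c * b"
      proof (rule add_mono)
        have "X i * \<bar>quad \<xi> (Q g)\<bar> \<le> (a * X h powr golden) * (2 * L (h - 1) * L h)"
          using Xi quad_Q_consecutive[OF g(2)] a by (intro mult_mono) auto
        also have "\<dots> = 2 * a * (L (h - 1) * (X h powr golden * L h))" by simp
        also have "\<dots> \<le> 2 * a * ((C * X h powr (1 - golden)) * (X h powr golden * L h))"
          using L_decay[of "h - 1"] gh a by (intro mult_left_mono mult_right_mono) auto
        also have "\<dots> = 2 * C * a * (X h powr (1 - golden) * X h powr golden * L h)" by simp
        also have "\<dots> = 2 * C * a * (X h * L h)" by (subst powr_add[symmetric]) simp
        also have "\<dots> \<le> 2 * C * a * b" using a b hi C_pos by (intro mult_left_mono) auto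
        finally show "X i * \<bar>quad \<xi> (Q g)\<bar> \<le> 2 * C * a * b" .
        have "X g powr (golden - 1) \<le> X g powr 1"
          using X_ge_1[of g] golden_bounds by (intro powr_mono) auto
        also have "\<dots> \<le> X i" using X_mono[of g i] gh hi by simp
        finally have "size1 (Q g) * L i \<le> c * X i * L i"
          using sizeQ c by (intro mult_right_mono) (auto intro: order.trans mult_left_mono)
        also have "\<dots> \<le> c * b" using XLi c by (simp add: mult.assoc)
        finally show "size1 (Q g) * L i \<le> c * b" .
      qed
      finally show ?thesis using K(4) by simp
    qed
    show ?thesis
      using i(2) upper XLi K(2) size nonzero bounded unfolding X_def L_def
      by (intro exI[of _ "x i"] exI[of _ "Q g"]) auto
  qed
  moreover have "0 < K" using a K by linarith
  ultimately show ?thesis by blast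
qed

end

section \<open>Minimal points of an extremal number\<close>

lemma err_less_1_c0_eq_0:
  assumes "err \<xi> z < 1" "c0 z = 0"
  shows "z = zero3"
  using assms by (cases z) (auto simp: err_def)

text \<open>
  The next point is chosen with least \<open>\<bar>c0 z\<bar>\<close> among the nonzero points whose error is below that of
  the current one. Starting with errors below \<open>1/2\<close> makes the sizes strictly increasing: two points of equal size
  differ, up to sign, by a point with first coordinate \<open>0\<close> and error below \<open>1\<close>, which is zero.
\<close>

lemma exists_minimal_points:
  assumes "extremal \<xi>"
  shows "\<exists>C x. minimal_points \<xi> C x"
proof -
  have notalg: "\<not> (algebraic \<xi> \<and> alg_degree \<xi> \<le> 2)"
    using assms by (simp add: extremal_def)
  note indep = not_quadratic_imp_independent_powers[OF notalg]
  obtain c where c: "0 < c" and solve: "\<And>X. 1 \<le> X \<Longrightarrow> \<exists>x0 x1 x2 :: int. (x0, x1, x2) \<noteq> (0, 0, 0) \<and>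
      \<bar>real_of_int x0\<bar> \<le> X \<and>
      \<bar>real_of_int x0 * \<xi> - real_of_int x1\<bar> \<le> c * X powr (- 1 / golden) \<and>
      \<bar>real_of_int x0 * \<xi>\<^sup>2 - real_of_int x2\<bar> \<le> c * X powr (- 1 / golden)"
    using assms unfolding extremal_def by blast
  have expo: "- 1 / golden = 1 - golden"
    using inverse_golden by simp
  have sol: "\<exists>z. z \<noteq> zero3 \<and> \<bar>of_int (c0 z)\<bar> \<le> Z \<and> err \<xi> z \<le> c * Z powr (1 - golden)"
    if Z: "1 \<le> Z" for Z :: real
  proof -
    obtain a b d where "(a, b, d) \<noteq> (0, 0, 0)" "\<bar>real_of_int a\<bar> \<le> Z"
      "\<bar>real_of_int a * \<xi> - real_of_int b\<bar> \<le> c * Z powr (1 - golden)"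
      "\<bar>real_of_int a * \<xi>\<^sup>2 - real_of_int d\<bar> \<le> c * Z powr (1 - golden)"
      using solve[OF Z] unfolding expo by blast
    then show ?thesis
      by (intro exI[of _ "Triple a b d"]) (auto simp: err_def)
  qed
  have small: "\<exists>z. z \<noteq> zero3 \<and> err \<xi> z < e" if "0 < e" for e
  proof -
    have "((\<lambda>Z::real. c * Z powr (1 - golden)) \<longlongrightarrow> 0) at_top"
      using golden_bounds by (intro tendsto_mult_right_zero tendsto_neg_powr filterlim_ident) auto
    then have "\<forall>\<^sub>F Z::real in at_top. c * Z powr (1 - golden) < e \<and> 1 \<le> Z"
      using that by (intro eventually_conj order_tendstoD(2) eventually_ge_at_top)
    then obtain Z :: real where "c * Z powr (1 - golden) < e" "1 \<le> Z"
      by (auto simp: eventually_at_top_linorder)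
    then show ?thesis using sol[of Z] by force
  qed
  have err_pos: "0 < err \<xi> z" if "z \<noteq> zero3" for z
  proof (rule ccontr)
    assume "\<not> 0 < err \<xi> z"
    then have z: "of_int (c0 z) * \<xi> - of_int (c1 z) = 0" "of_int (c0 z) * \<xi>\<^sup>2 - of_int (c2 z) = 0"
      unfolding err_def by auto
    then have "c0 z = 0 \<and> c1 z = 0"
      using indep[of "- c1 z" "c0 z" 0] by simp
    then show False using z that by (cases z) auto
  qed
  define best where "best e z \<longleftrightarrow> z \<noteq> zero3 \<and> err \<xi> z < e \<and>
      (\<forall>w. w \<noteq> zero3 \<and> err \<xi> w < e \<longrightarrow> \<bar>c0 z\<bar> \<le> \<bar>c0 w\<bar>)" for e z
  have "\<exists>z. best e z" if "0 < e" for e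
  proof -
    obtain z where "z \<noteq> zero3 \<and> err \<xi> z < e"
      and "\<And>w. w \<noteq> zero3 \<and> err \<xi> w < e \<Longrightarrow> nat \<bar>c0 z\<bar> \<le> nat \<bar>c0 w\<bar>"
      using ex_has_least_nat[of "\<lambda>z. z \<noteq> zero3 \<and> err \<xi> z < e" _ "\<lambda>z. nat \<bar>c0 z\<bar>"] small[OF \<open>0 < e\<close>]
      by blast
    then show ?thesis unfolding best_def by (intro exI[of _ z]) (auto simp: nat_le_eq_zle)
  qed
  then have best: "best e (SOME z. best e z)" if "0 < e" for e
    using that by (blast intro: someI_ex)
  define x where "x = rec_nat (SOME z. best (1 / 2) z) (\<lambda>_ y. SOME z. best (err \<xi> y) z)"
  have x0: "best (1 / 2) (x 0)" using best by (simp add: x_def)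
  have nonzero: "x m \<noteq> zero3" for m
  proof (induction m)
    case 0
    then show ?case using x0 by (simp add: best_def)
  next
    case (Suc m)
    have "best (err \<xi> (x m)) (x (Suc m))"
      using best[OF err_pos[OF Suc]] by (simp add: x_def)
    then show ?case by (simp add: best_def)
  qed
  have step: "best (err \<xi> (x m)) (x (Suc m))" for m
    using best[OF err_pos[OF nonzero[of m]]] by (simp add: x_def)
  have err_less: "err \<xi> (x (Suc m)) < err \<xi> (x m)" for m
    using step by (simp add: best_def)
  have err_half: "err \<xi> (x m) < 1 / 2" for m
  proof (induction m)
    case 0
    then show ?case using x0 by (simp add: best_def)
  next
    case (Suc m)
    then show ?case using err_less[of m] by linarith
  qed
  have minimal: "err \<xi> (x m) \<le> err \<xi> z" if "z \<noteq> zero3" "\<bar>c0 z\<bar> < \<bar>c0 (x (Suc m))\<bar>" for m z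
    using step[of m] that unfolding best_def by (meson not_le)
  have c0_ge_1: "1 \<le> \<bar>c0 (x m)\<bar>" for m
    using err_less_1_c0_eq_0[of \<xi> "x m"] err_half[of m] nonzero[of m] by linarith
  have c0_less: "\<bar>c0 (x m)\<bar> < \<bar>c0 (x (Suc m))\<bar>" for m
  proof -
    have "\<bar>c0 (x m)\<bar> \<le> \<bar>c0 (x (Suc m))\<bar>"
    proof (cases m)
      case 0
      then show ?thesis using x0 nonzero[of 1] err_half[of 1] by (simp add: best_def)
    next
      case (Suc k)
      then show ?thesis
        using step[of k] nonzero[of "Suc m"] err_less[of m] err_less[of k]
        unfolding best_def by (metis order.strict_trans)
    qed
    moreover have "\<bar>c0 (x m)\<bar> \<noteq> \<bar>c0 (x (Suc m))\<bar>"
    proof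
      assume "\<bar>c0 (x m)\<bar> = \<bar>c0 (x (Suc m))\<bar>"
      then obtain s :: int where s: "\<bar>s\<bar> = 1" "c0 (x (Suc m)) = s * c0 (x m)"
        by (metis abs_eq_iff abs_minus_cancel abs_one mult_1 mult_minus_left)
      let ?w = "comb 1 (x (Suc m)) (- s) (x m)"
      have s1: "\<bar>real_of_int s\<bar> = 1" using s(1) by linarith
      have "err \<xi> ?w \<le> err \<xi> (x (Suc m)) + err \<xi> (x m)"
        using err_comb[of \<xi> 1 "x (Suc m)" "- s" "x m"] s1 by simp
      also have "\<dots> < 1" using err_half[of m] err_half[of "Suc m"] by linarith
      finally have "?w = zero3"
        using s(2) by (intro err_less_1_c0_eq_0) (auto simp: comb_def)
      then have "x (Suc m) = comb s (x m) 0 zero3"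
        by (cases "x (Suc m)") (simp add: comb_def)
      then have "err \<xi> (x (Suc m)) = err \<xi> (x m)"
        by (simp add: err_scale s1)
      then show False using err_less[of m] by simp
    qed
    ultimately show ?thesis by simp
  qed
  define C where "C = c * 2 powr (golden - 1)"
  have decay: "err \<xi> (x m) \<le> C * \<bar>of_int (c0 (x (Suc m)))\<bar> powr (1 - golden)" for m
  proof -
    \<comment> \<open>half the size of the next point is below that size, so no nonzero point within it beats the error of \<open>x m\<close>\<close>
    define Y where "Y = \<bar>real_of_int (c0 (x (Suc m)))\<bar>"
    have "2 \<le> \<bar>c0 (x (Suc m))\<bar>" using c0_less[of m] c0_ge_1[of m] by linarith
    then have Y: "2 \<le> Y" unfolding Y_def by linarith
    then obtain z where z: "z \<noteq> zero3" "\<bar>of_int (c0 z)\<bar> \<le> Y / 2" "err \<xi> z \<le> c * (Y / 2) powr (1 - golden)"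
      using sol[of "Y / 2"] by auto
    have "\<bar>c0 z\<bar> < \<bar>c0 (x (Suc m))\<bar>" using z(2) Y unfolding Y_def by linarith
    then have "err \<xi> (x m) \<le> err \<xi> z" using z(1) by (intro minimal)
    also have "\<dots> \<le> c * (Y / 2) powr (1 - golden)" by (rule z(3))
    also have "(Y / 2) powr (1 - golden) = 2 powr (golden - 1) * Y powr (1 - golden)"
      using Y powr_minus_divide[of 2 "golden - 1"] by (simp add: powr_divide)
    finally show ?thesis by (simp add: C_def Y_def)
  qed
  have "minimal_points \<xi> C x"
  proof
    show "0 < C" using c by (simp add: C_def)
    show "err \<xi> (x m) \<le> 1" for m using err_half[of m] by linarith
  qed (fact indep c0_ge_1 c0_less err_less minimal decay)+
  then show ?thesis by blast
qed

section \<open>Values of monic cubic polynomials\<close>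

lemma integer_multiples_gap:
  fixes \<xi> K :: real
  assumes "\<And>a b :: int. of_int a + of_int b * \<xi> = 0 \<Longrightarrow> b = 0"
  shows "\<exists>\<delta>>0. \<forall>m n :: int. n \<noteq> 0 \<and> \<bar>of_int n\<bar> \<le> K \<longrightarrow> \<delta> \<le> \<bar>of_int m - of_int n * \<xi>\<bar>"
proof -
  define S where "S = {n :: int. n \<noteq> 0 \<and> \<bar>of_int n\<bar> \<le> K}"
  define gap where "gap n = \<bar>of_int n * \<xi> - of_int (round (of_int n * \<xi>))\<bar>" for n :: int
  have "S \<subseteq> {- \<lfloor>K\<rfloor>..\<lfloor>K\<rfloor>}"
    by (auto simp: S_def le_floor_iff abs_le_iff minus_le_iff)
  then have fin: "finite S" by (rule finite_subset) simp
  have pos: "0 < gap n" if "n \<in> S" for n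
    using assms[of "- round (of_int n * \<xi>)" n] that by (auto simp: gap_def S_def)
  define \<delta> where "\<delta> = Min (insert 1 (gap ` S))"
  have "0 < \<delta>" using fin pos by (auto simp: \<delta>_def)
  moreover have "\<delta> \<le> \<bar>of_int m - of_int n * \<xi>\<bar>" if "n \<in> S" for m n
  proof -
    have "\<delta> \<le> gap n" using fin that by (auto simp: \<delta>_def intro: Min_le)
    also have "\<dots> \<le> \<bar>of_int n * \<xi> - of_int m\<bar>"
      unfolding gap_def by (rule round_diff_minimal)
    finally show ?thesis by (simp add: abs_minus_commute)
  qed
  ultimately show ?thesis unfolding S_def by blast
qed

text \<open>
  The exponents: for \<open>Z\<close> a large multiple of \<open>H powr ((\<gamma> + 1) / 2)\<close> the unwanted term
  \<open>H * Z powr (2 \<gamma> - 4)\<close> is a small constant because \<open>(\<gamma> + 1) (\<gamma> - 2) = -1\<close>, and the size \<open>Y\<close> of the point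
  found for \<open>Z\<close> satisfies \<open>Y powr (2 \<gamma> - 2) = O(H powr (\<gamma> + 1))\<close> because \<open>\<gamma> (\<gamma> - 1) = 1\<close>.
\<close>

lemma cubic_value_lower_bound:
  assumes "extremal \<xi>"
  shows "\<exists>c>0. \<forall>(p::int) (q::int) (r::int) H. 1 \<le> H \<and> \<bar>of_int p\<bar> \<le> H \<and> \<bar>of_int q\<bar> \<le> H \<longrightarrow>
    c * H powr - (golden + 1) \<le> \<bar>\<xi> ^ 3 + of_int p * \<xi>\<^sup>2 + of_int q * \<xi> + of_int r\<bar>"
proof -
  obtain C x where "minimal_points \<xi> C x" using exists_minimal_points[OF assms] by blast
  then interpret minimal_points \<xi> C x .
  obtain K Z0 where K: "0 < K" and points: "\<And>Z. Z0 \<le> Z \<Longrightarrow>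
     \<exists>z q. Z \<le> \<bar>of_int (c0 z)\<bar> \<and> \<bar>of_int (c0 z)\<bar> \<le> K * Z powr golden \<and>
     \<bar>of_int (c0 z)\<bar> * err \<xi> z \<le> K \<and> size1 q \<le> K * \<bar>of_int (c0 z)\<bar> powr (2 * golden - 3) \<and>
     pairing q z \<noteq> 0 \<and> \<bar>of_int (pairing q z)\<bar> \<le> K"
    using points_and_forms by blast
  obtain \<delta> where \<delta>: "0 < \<delta>"
    "\<And>m n :: int. n \<noteq> 0 \<Longrightarrow> \<bar>of_int n\<bar> \<le> K \<Longrightarrow> \<delta> \<le> \<bar>of_int m - of_int n * \<xi>\<bar>"
    using integer_multiples_gap[of \<xi> K] independent[of _ _ 0] by auto
  define M where "M = K\<^sup>2 * (3 + \<bar>\<xi>\<bar>)"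
  have "((\<lambda>B::real. M * B powr (2 * golden - 4)) \<longlongrightarrow> 0) at_top"
    using golden_bounds by (intro tendsto_mult_right_zero tendsto_neg_powr filterlim_ident) auto
  then have "\<forall>\<^sub>F B::real in at_top. M * B powr (2 * golden - 4) < \<delta> / 2 \<and> max 1 Z0 \<le> B"
    using \<delta> by (intro eventually_conj order_tendstoD(2) eventually_ge_at_top) auto
  then obtain B :: real where B: "M * B powr (2 * golden - 4) < \<delta> / 2" "1 \<le> B" "Z0 \<le> B"
    by (auto simp: eventually_at_top_linorder)
  define D where "D = (K * B powr golden) powr (2 * golden - 2)"
  have D: "0 < D" using K B by (simp add: D_def)
  have "\<delta> / (2 * K * D) * H powr - (golden + 1) \<le> \<bar>\<xi> ^ 3 + of_int p * \<xi>\<^sup>2 + of_int q * \<xi> + of_int r\<bar>"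
    if H: "1 \<le> H" "\<bar>of_int p\<bar> \<le> H" "\<bar>of_int q\<bar> \<le> H" for p q r :: int and H :: real
  proof -
    define Z where "Z = B * H powr ((golden + 1) / 2)"
    have "1 \<le> H powr ((golden + 1) / 2)"
      using H golden_bounds by (intro ge_one_powr_ge_zero) auto
    then have BZ: "B \<le> Z" using B mult_left_mono[of 1 "H powr ((golden + 1) / 2)" B] by (simp add: Z_def)
    obtain z f where z: "Z \<le> \<bar>of_int (c0 z)\<bar>" "\<bar>of_int (c0 z)\<bar> \<le> K * Z powr golden"
     "\<bar>of_int (c0 z)\<bar> * err \<xi> z \<le> K" "size1 f \<le> K * \<bar>of_int (c0 z)\<bar> powr (2 * golden - 3)"
     "pairing f z \<noteq> 0" "\<bar>of_int (pairing f z)\<bar> \<le> K"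
      using points[of Z] B BZ by auto
    define Y where "Y = \<bar>real_of_int (c0 z)\<bar>"
    have Y: "0 < Y" using z(1) BZ B unfolding Y_def by linarith
    define V where "V = \<xi> ^ 3 + of_int p * \<xi>\<^sup>2 + of_int q * \<xi> + of_int r"
    \<comment> \<open>the integer that is close to \<open>c0 z * \<xi> ^ 3\<close> when \<open>V\<close> is small\<close>
    define y where "y = - (p * c2 z + q * c1 z + r * c0 z)"
    \<comment> \<open>the value of \<open>f\<close> at \<open>(c1 z, c2 z, y)\<close>, a point close to \<open>\<xi>\<close> times \<open>z\<close>\<close>
    define m where "m = c0 f * c1 z + c1 f * c2 z + c2 f * y"
    obtain e1 e2 where e: "of_int (c1 z) = of_int (c0 z) * \<xi> - e1"
      "of_int (c2 z) = of_int (c0 z) * \<xi>\<^sup>2 - e2" "\<bar>e1\<bar> \<le> err \<xi> z" "\<bar>e2\<bar> \<le> err \<xi> z"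
      by (rule errE)
    let ?E = "err \<xi> z" and ?W = "Y * \<bar>V\<bar> + (3 + \<bar>\<xi>\<bar>) * H * err \<xi> z"
    have E0: "0 \<le> ?E" by (rule err_nonneg)
    have xe1: "\<bar>\<xi> * e1\<bar> \<le> \<bar>\<xi>\<bar> * ?E" and xe2: "\<bar>\<xi> * e2\<bar> \<le> \<bar>\<xi>\<bar> * ?E"
      using e by (intro abs_mult_mono; simp)+
    have pe: "\<bar>of_int p * e2\<bar> \<le> H * ?E" and qe: "\<bar>of_int q * e1\<bar> \<le> H * ?E"
      using e H by (intro abs_mult_mono; simp)+
    have E1: "?E \<le> H * ?E" and xE: "\<bar>\<xi>\<bar> * ?E \<le> \<bar>\<xi>\<bar> * (H * ?E)"
      using mult_right_mono[OF H(1) E0] by (simp_all add: mult_left_mono)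
    have YV: "\<bar>of_int (c0 z) * V\<bar> = Y * \<bar>V\<bar>" by (simp add: Y_def abs_mult)
    have W: "?W = Y * \<bar>V\<bar> + 3 * (H * ?E) + \<bar>\<xi>\<bar> * (H * ?E)"
      by (simp add: algebra_simps)
    have YV0: "0 \<le> Y * \<bar>V\<bar>" using Y by simp
    have HE0: "0 \<le> H * ?E" using E0 E1 by linarith
    have a1: "\<bar>- e1\<bar> \<le> ?W"
      using e E1 YV0 HE0 xE E0 unfolding W by (smt (verit) abs_ge_zero mult_nonneg_nonneg)
    have a2: "\<bar>\<xi> * e1 - e2\<bar> \<le> ?W"
      using e E1 YV0 HE0 xE xe1 unfolding W by linarith
    have "of_int y - \<xi> * of_int (c2 z) = \<xi> * e2 + of_int p * e2 + of_int q * e1 - of_int (c0 z) * V"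
      by (simp add: y_def V_def e algebra_simps power2_eq_square power3_eq_cube)
    then have a3: "\<bar>of_int y - \<xi> * of_int (c2 z)\<bar> \<le> ?W"
      using E1 HE0 xE xe2 pe qe YV unfolding W by linarith
    have "of_int m - of_int (pairing f z) * \<xi>
        = of_int (c0 f) * (- e1) + of_int (c1 f) * (\<xi> * e1 - e2)
          + of_int (c2 f) * (of_int y - \<xi> * of_int (c2 z))"
      by (simp add: m_def pairing_def e algebra_simps power2_eq_square)
    also have "\<bar>\<dots>\<bar> \<le> \<bar>of_int (c0 f)\<bar> * ?W + \<bar>of_int (c1 f)\<bar> * ?W + \<bar>of_int (c2 f)\<bar> * ?W"
      by (intro order.trans[OF abs_triangle_ineq] add_mono abs_mult_mono order_refl a1 a2 a3)
    also have "\<dots> = size1 f * ?W" by (simp add: size1_def distrib_right)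
    also have "\<dots> \<le> (K * Y powr (2 * golden - 3)) * ?W"
      using z(4) YV0 HE0 unfolding Y_def[symmetric] W by (intro mult_right_mono) auto
    finally have "\<delta> \<le> K * Y powr (2 * golden - 3) * ?W"
      using \<delta>(2)[OF z(5,6), of m] by simp
    also have "\<dots> = K * (Y powr (2 * golden - 3) * Y powr 1) * \<bar>V\<bar>
        + K * (3 + \<bar>\<xi>\<bar>) * H * (Y powr (2 * golden - 3) * ?E)"
      using Y by (simp add: algebra_simps)
    also have "Y powr (2 * golden - 3) * Y powr 1 = Y powr (2 * golden - 2)"
      by (subst powr_add[symmetric]) simp
    finally have \<delta>_le: "\<delta> \<le> K * Y powr (2 * golden - 2) * \<bar>V\<bar>
        + K * (3 + \<bar>\<xi>\<bar>) * H * (Y powr (2 * golden - 3) * ?E)" .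
    have "Y powr (2 * golden - 3) = Y powr (2 * golden - 4) * Y powr 1"
      by (subst powr_add[symmetric]) simp
    then have "Y powr (2 * golden - 3) * ?E = Y powr (2 * golden - 4) * (Y * ?E)"
      using Y by simp
    also have "\<dots> \<le> Z powr (2 * golden - 4) * K"
      using z(1,3) BZ B golden_bounds Y E0 unfolding Y_def[symmetric]
      by (intro mult_mono powr_mono2') auto
    also have "Z powr (2 * golden - 4) = B powr (2 * golden - 4) * H powr - 1"
    proof -
      have "(golden + 1) / 2 * (2 * golden - 4) = - 1" using golden_sq by (simp add: algebra_simps)
      then show ?thesis using B H by (simp add: Z_def powr_mult powr_powr)
    qed
    finally have "K * (3 + \<bar>\<xi>\<bar>) * H * (Y powr (2 * golden - 3) * ?E)
        \<le> K * (3 + \<bar>\<xi>\<bar>) * H * (B powr (2 * golden - 4) * H powr - 1 * K)"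
      using K H by (intro mult_left_mono) auto
    also have "\<dots> = M * B powr (2 * golden - 4) * (H powr 1 * H powr - 1)"
      using H by (simp add: M_def power2_eq_square)
    also have "\<dots> = M * B powr (2 * golden - 4)"
      using H by (subst powr_add[symmetric]) simp
    also have "\<dots> < \<delta> / 2" by (rule B(1))
    finally have lower: "\<delta> / 2 \<le> K * Y powr (2 * golden - 2) * \<bar>V\<bar>" using \<delta>_le by linarith
    have "Y powr (2 * golden - 2) \<le> (K * Z powr golden) powr (2 * golden - 2)"
      using z(2) Y golden_bounds unfolding Y_def[symmetric] by (intro powr_mono2) auto
    also have "\<dots> = D * H powr (golden + 1)"
    proof -
      have "(golden + 1) / 2 * golden * (2 * golden - 2) = (golden + 1) * (golden * golden - golden)"
        by (simp add: algebra_simps diff_divide_distrib)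
      also have "\<dots> = golden + 1" by (simp add: golden_sq)
      finally have expo: "(golden + 1) / 2 * golden * (2 * golden - 2) = golden + 1" .
      have "(K * Z powr golden) powr (2 * golden - 2)
          = D * ((H powr ((golden + 1) / 2)) powr golden) powr (2 * golden - 2)"
        using B H K by (simp add: D_def Z_def powr_mult)
      then show ?thesis unfolding powr_powr expo .
    qed
    finally have "K * Y powr (2 * golden - 2) * \<bar>V\<bar> \<le> K * (D * H powr (golden + 1)) * \<bar>V\<bar>"
      using K by (intro mult_right_mono mult_left_mono) auto
    then have "\<delta> / 2 \<le> K * D * H powr (golden + 1) * \<bar>V\<bar>" using lower by simp
    then have "\<delta> / 2 * H powr - (golden + 1)
        \<le> K * D * H powr (golden + 1) * \<bar>V\<bar> * H powr - (golden + 1)"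
      by (rule mult_right_mono) simp
    also have "\<dots> = K * D * \<bar>V\<bar> * (H powr (golden + 1) * H powr - (golden + 1))" by simp
    also have "\<dots> = K * D * \<bar>V\<bar>" using H by (subst powr_add[symmetric]) simp
    finally have "\<delta> / 2 * H powr - (golden + 1) / (K * D) \<le> \<bar>V\<bar>"
      using K D by (simp add: divide_le_eq mult_ac)
    then show ?thesis by (simp add: V_def mult_ac)
  qed
  moreover have "0 < \<delta> / (2 * K * D)" using \<delta> K D by simp
  ultimately show ?thesis by blast
qed

theorem theorem1p5:
  fixes \<xi> :: real
  assumes "extremal \<xi>"
  shows "\<exists>c>0. \<forall>\<alpha>::complex. algebraic_int \<alpha> \<and> alg_degree \<alpha> \<le> 3 \<longrightarrow>
           cmod (of_real \<xi> - \<alpha>) \<ge> c * alg_height \<alpha> powr (- (golden\<^sup>2) - 1)"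
proof -
  obtain c where c: "0 < c" "\<And>(p::int) (q::int) (r::int) H.
      1 \<le> H \<Longrightarrow> \<bar>of_int p\<bar> \<le> H \<Longrightarrow> \<bar>of_int q\<bar> \<le> H \<Longrightarrow>
      c * H powr - (golden + 1) \<le> \<bar>\<xi> ^ 3 + of_int p * \<xi>\<^sup>2 + of_int q * \<xi> + of_int r\<bar>"
    using cubic_value_lower_bound[OF assms] by blast
  define A where "A = \<bar>\<xi>\<bar> + 1"
  have A: "1 \<le> A" by (simp add: A_def)
  define c' where "c' = min 1 (c / (6 * A\<^sup>2))"
  have c': "0 < c'" "c' \<le> 1" "c' \<le> c / (6 * A\<^sup>2)"
    using c A by (auto simp: c'_def)
  have expo: "- (golden\<^sup>2) - 1 = - (golden + 1) + - 1"
    using golden_sq by (simp add: power2_eq_square)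
  have "c' * alg_height \<alpha> powr (- (golden\<^sup>2) - 1) \<le> cmod (of_real \<xi> - \<alpha>)"
    if \<alpha>: "algebraic_int \<alpha>" "alg_degree \<alpha> \<le> 3" for \<alpha> :: complex
  proof -
    define H where "H = alg_height \<alpha>"
    obtain p q r :: int where root: "\<alpha> ^ 3 + of_int p * \<alpha>\<^sup>2 + of_int q * \<alpha> + of_int r = 0"
      and H: "\<bar>of_int p\<bar> \<le> H" "\<bar>of_int q\<bar> \<le> H" "1 \<le> H"
      using alg_int_monic_cubic[OF \<alpha>] unfolding H_def by blast
    let ?d = "cmod (of_real \<xi> - \<alpha>)"
    show ?thesis
    proof (cases "?d \<le> 1")
      case False
      have "- (golden\<^sup>2) - 1 \<le> 0"
        using zero_le_power2[of golden] by linarith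
      then have "H powr (- (golden\<^sup>2) - 1) \<le> H powr 0"
        using H by (intro powr_mono) auto
      then have "c' * H powr (- (golden\<^sup>2) - 1) \<le> 1 * 1"
        using c' H by (intro mult_mono) auto
      then show ?thesis using False by (simp add: H_def)
    next
      case True
      define V where "V = \<xi> ^ 3 + of_int p * \<xi>\<^sup>2 + of_int q * \<xi> + of_int r"
      define u where "u = (of_real \<xi>)\<^sup>2 + of_real \<xi> * \<alpha> + \<alpha>\<^sup>2 + of_int p * (of_real \<xi> + \<alpha>) + of_int q"
      have n\<xi>: "cmod (of_real \<xi>) \<le> A" by (simp add: A_def)
      have n\<alpha>: "cmod \<alpha> \<le> A"
        using norm_triangle_ineq2[of \<alpha> "of_real \<xi>"] True by (simp add: A_def norm_minus_commute)
      have "of_real V = of_real V - (\<alpha> ^ 3 + of_int p * \<alpha>\<^sup>2 + of_int q * \<alpha> + of_int r)"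
        using root by simp
      also have "\<dots> = (of_real \<xi> - \<alpha>) * u"
        by (simp add: V_def u_def algebra_simps power2_eq_square power3_eq_cube)
      finally have "\<bar>V\<bar> = ?d * cmod u"
        by (metis norm_mult norm_of_real)
      also have "cmod u \<le> A * A + A * A + A * A + H * (A + A) + H"
        unfolding u_def power2_eq_square
        using n\<xi> n\<alpha> H A
        by (intro order.trans[OF norm_triangle_ineq] add_mono order.trans[OF norm_mult_ineq] mult_mono)
          auto
      also have "\<dots> \<le> 6 * A\<^sup>2 * H"
      proof -
        have "A * A \<le> A * A * H" using H(3) A mult_left_mono[of 1 H "A * A"] by simp
        moreover have "H * A \<le> A * A * H" "H \<le> A * A * H"
          using H(3) A mult_mono[of 1 A 1 A] mult_left_mono[of 1 A "A * H"] mult_right_mono[of 1 "A * A" H]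
          by (simp_all add: mult_ac)
        ultimately show ?thesis by (simp add: power2_eq_square algebra_simps)
      qed
      finally have V: "\<bar>V\<bar> \<le> ?d * (6 * A\<^sup>2 * H)" by (simp add: mult_left_mono)
      have "c' * H powr (- (golden\<^sup>2) - 1) \<le> c / (6 * A\<^sup>2) * H powr (- (golden\<^sup>2) - 1)"
        using c' by (intro mult_right_mono) auto
      also have "\<dots> = c * H powr - (golden + 1) / (6 * A\<^sup>2 * H)"
        using H unfolding expo powr_add by (simp add: powr_minus field_simps)
      also have "\<dots> \<le> \<bar>V\<bar> / (6 * A\<^sup>2 * H)"
        using c(2)[OF H(3,1,2), of r] A H(3) by (intro divide_right_mono) (auto simp: V_def)
      also have "\<dots> \<le> ?d"
        using V A H(3) by (simp add: divide_le_eq)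
      finally show ?thesis by (simp add: H_def)
    qed
  qed
  then show ?thesis using c'(1) by blast
qed

end
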